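(* There exists a universal constant $C\in(0,1]$ such that, for all $n\ge3$, any $\rho$-estimator $\widehat s$ on the set $\mathscr F'$ of log-concave densities on the line satisfies, for every density $s\in\mathscr L_\mu$, $$C\,\mathbb E_s\left[h^2(s,\widehat s)\right]\le\inf_{D\ge1}\left[\inf_{\overline s\in\overline V'(D)}h^2(s,\overline s)+\frac Dn\log_+^3\left(\frac nD\right)\right],$$ where the infimum is over integers $D\ge1$.
   Context: Setting. $\mu$ is the Lebesgue measure on $\mathbb R$ and $\mathscr L_\mu$ is the set of probability densities on $\mathbb R$ with respect to $\mu$. The Hellinger distance is $h(t,u)=\left[\frac12\int(\sqrt t-\sqrt u)^2d\mu\right]^{1/2}$. One observes i.i.d. random variables $X_1,\dots,X_n$ ($n\ge3$) with density $s\in\mathscr L_\mu$; $\mathbb E_s$ is the expectation when the true density is $s$. $\log_+(x)=\max\{\log x,1\}$. $\mathscr F'$ is the set of all densities in $\mathscr L_\mu$ of the form $\mathbf 1_I\exp(g)$ for some open interval $I$ of $\mathbb R$, possibly of infinite length, and some concave function $g$ on $I$. For an integer $D\ge1$, $\overline V'(D)$ is the subset of those elements of $\mathscr F'$ for which $g$ is piecewise affine on $I$ with $D$ pieces. $\rho$-estimators. Let $\psi(u)=\frac{u-1}{\sqrt{1+u^2}}$ for $u\in[0,+\infty)$ and $\psi(+\infty)=1$. For densities $t,t'$ put $$\mathbf T(\boldsymbol X,t,t')=\frac n2\left[h^2\left(t,\tfrac{t+t'}2\right)-h^2\left(t',\tfrac{t+t'}2\right)\right]+\frac1{\sqrt2}\sum_{i=1}^n\psi\left(\sqrt{\tfrac{t'}{t}(X_i)}\right),$$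 with the conventions $0/0=1$ and $a/0=+\infty$ for $a>0$. For a model $\overline S\subset\mathscr L_\mu$ and an at most countable subset $S$ of $\overline S$ which is dense in $\overline S$ for the Hellinger distance, let $\boldsymbol\Upsilon(S,t)=\sup_{t'\in S}\mathbf T(\boldsymbol X,t,t')$. A $\rho$-estimator on $\overline S$ is any (measurable) element $\widehat s$ of the closure (for $h$) of $\{t\in S:\ \boldsymbol\Upsilon(S,t)\le\inf_{t'\in S}\boldsymbol\Upsilon(S,t')+35.7\}$. *)

theory Defs
  imports "HOL-Probability.Probability"
begin

definition densities :: "(real \<Rightarrow> real) set" where
  "densities = {t \<in> borel_measurable borel. (\<forall>x. 0 \<le> t x) \<and> (\<integral>\<^sup>+x. ennreal (t x) \<partial>lborel) = 1}"

definition hellinger :: "(real \<Rightarrow> real) \<Rightarrow> (real \<Rightarrow> real) \<Rightarrow> real" where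
  "hellinger t u = sqrt (1/2 * (\<integral>x. (sqrt (t x) - sqrt (u x))\<^sup>2 \<partial>lborel))"

definition hellinger_closure :: "(real \<Rightarrow> real) set \<Rightarrow> (real \<Rightarrow> real) set" where
  "hellinger_closure A = {u \<in> densities. \<forall>\<epsilon>>0. \<exists>t\<in>A. hellinger u t < \<epsilon>}"

text \<open>Borel sigma-algebra of the (pseudo-)metric \<open>hellinger\<close> on \<open>densities\<close>; densities are
  functions, not classes modulo null sets.\<close>

definition hellinger_borel :: "(real \<Rightarrow> real) measure" where
  "hellinger_borel = sigma densities
     {U. U \<subseteq> densities \<and> (\<forall>t\<in>U. \<exists>\<epsilon>>0. \<forall>u\<in>densities. hellinger t u < \<epsilon> \<longrightarrow> u \<in> U)}"

definition log_concave_densities :: "(real \<Rightarrow> real) set" where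
  "log_concave_densities = {t \<in> densities. \<exists>I g. open I \<and> is_interval I \<and> concave_on I g \<and>
     t = (\<lambda>x. indicator I x * exp (g x))}"

text \<open>\<open>D\<close> is the number of intervals in a partition of \<open>I\<close>; neighbouring pieces may carry the
  same affine function.\<close>

definition piecewise_affine_on :: "real set \<Rightarrow> nat \<Rightarrow> (real \<Rightarrow> real) \<Rightarrow> bool" where
  "piecewise_affine_on I D g \<longleftrightarrow> (\<exists>P. partition_on I P \<and> finite P \<and> card P = D \<and>
     (\<forall>J\<in>P. is_interval J \<and> (\<exists>a b. \<forall>x\<in>J. g x = a * x + b)))"

definition log_affine_densities :: "nat \<Rightarrow> (real \<Rightarrow> real) set" where
  "log_affine_densities D = {t \<in> densities. \<exists>I g. open I \<and> is_interval I \<and> concave_on I g \<and>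
     piecewise_affine_on I D g \<and> t = (\<lambda>x. indicator I x * exp (g x))}"

definition rho_psi :: "ereal \<Rightarrow> real" where
  "rho_psi u = (if u = \<infinity> then 1
     else (real_of_ereal u - 1) / sqrt (1 + (real_of_ereal u)\<^sup>2))"

text \<open>The square root of \<open>a / b\<close> for \<open>a, b \<ge> 0\<close>, with \<open>0 / 0 = 1\<close> and \<open>a / 0 = \<infinity>\<close>
  for \<open>a > 0\<close>.\<close>

definition sqrt_ratio :: "real \<Rightarrow> real \<Rightarrow> ereal" where
  "sqrt_ratio a b = (if b = 0 then (if a = 0 then 1 else \<infinity>) else ereal (sqrt (a / b)))"

definition rho_T :: "nat \<Rightarrow> (nat \<Rightarrow> real) \<Rightarrow> (real \<Rightarrow> real) \<Rightarrow> (real \<Rightarrow> real) \<Rightarrow> real" where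
  "rho_T n X t t' =
     real n / 2 * ((hellinger t (\<lambda>x. (t x + t' x) / 2))\<^sup>2 - (hellinger t' (\<lambda>x. (t x + t' x) / 2))\<^sup>2)
     + 1 / sqrt 2 * (\<Sum>i\<in>{1..n}. rho_psi (sqrt_ratio (t' (X i)) (t (X i))))"

text \<open>Suprema and infima are taken in \<open>real\<close>: on densities \<open>rho_T n X\<close> is bounded by a constant
  depending only on \<open>n\<close>.\<close>

definition rho_Upsilon :: "nat \<Rightarrow> (nat \<Rightarrow> real) \<Rightarrow> (real \<Rightarrow> real) set \<Rightarrow> (real \<Rightarrow> real) \<Rightarrow> real" where
  "rho_Upsilon n X S t = (SUP t'\<in>S. rho_T n X t t')"

definition rho_minimizers :: "nat \<Rightarrow> (nat \<Rightarrow> real) \<Rightarrow> (real \<Rightarrow> real) set \<Rightarrow> (real \<Rightarrow> real) set" where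
  "rho_minimizers n X S =
     {t \<in> S. rho_Upsilon n X S t \<le> (INF t'\<in>S. rho_Upsilon n X S t') + 35.7}"

text \<open>An estimator is a function of the sample \<open>X\<close>, a point of the product space over \<open>{1..n}\<close>.\<close>

definition rho_estimator ::
  "nat \<Rightarrow> (real \<Rightarrow> real) set \<Rightarrow> ((nat \<Rightarrow> real) \<Rightarrow> real \<Rightarrow> real) \<Rightarrow> bool" where
  "rho_estimator n M s_hat \<longleftrightarrow>
     s_hat \<in> measurable (PiM {1..n} (\<lambda>_. borel)) hellinger_borel \<and>
     (\<exists>S. countable S \<and> S \<subseteq> M \<and> M \<subseteq> hellinger_closure S \<and>
        (\<forall>X\<in>space (PiM {1..n} (\<lambda>_. borel)). s_hat X \<in> hellinger_closure (rho_minimizers n X S)))"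

definition iid_sample :: "nat \<Rightarrow> (real \<Rightarrow> real) \<Rightarrow> (nat \<Rightarrow> real) measure" where
  "iid_sample n s = PiM {1..n} (\<lambda>_. density lborel (\<lambda>x. ennreal (s x)))"

definition log_plus :: "real \<Rightarrow> real" where
  "log_plus x = max (ln x) 1"

end

theory Submission
  imports Defs "HOL-Real_Asymp.Real_Asymp"
begin

text \<open>
  Fix \<open>t\<close> log-affine with \<open>D\<close> pieces. With \<open>f\<^sub>u = \<psi>(sqrt (u / t))\<close> the expectation of \<open>T(X, t, u) / n\<close>
  is at most \<open>a h\<^sup>2(s, t) - b h\<^sup>2(s, u)\<close> and \<open>\<integral> f\<^sub>u\<^sup>2 s \<le> 6 (h\<^sup>2(s, t) + h\<^sup>2(s, u))\<close>, so it suffices to bound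
  the deviation of the empirical mean of \<open>f\<^sub>u\<close> by a small multiple of \<open>\<integral> f\<^sub>u\<^sup>2 s\<close> plus a remainder,
  uniformly over log-concave \<open>u\<close>. On a piece of \<open>t\<close> the function \<open>ln u - ln t\<close> is concave, so the sets
  \<open>{f\<^sub>u > c}\<close> and \<open>{f\<^sub>u < - c}\<close> are unions of at most \<open>2 D + 2\<close> intervals.

  No symmetrization or concentration inequality is needed: since the law of an observation has no atoms, such a
  union is sandwiched between two unions of cells of its \<open>1/n\<close>-quantile grid, which form a family of
  log-cardinality \<open>O(D log (n / D))\<close>, and the expectation of the maximum over this family is controlled by
  exponential moments. Cutting \<open>f\<^sub>u\<close> into \<open>M = n div D\<close> layers and using at height \<open>i / M\<close> the exponent
  \<open>\<epsilon> i / M\<close> turns the variance terms into \<open>\<epsilon> \<integral> f\<^sub>u\<^sup>2 s\<close> and the cost into the harmonic sum \<open>H\<^sub>M\<close>. The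
  resulting remainder is \<open>O(D log\<^sup>2 (n / D))\<close>.

  As \<open>t\<close> need not lie in the countable set \<open>S\<close> of the estimator, it is replaced by a sequence in \<open>S\<close>
  converging to it almost everywhere.
\<close>

section \<open>The function psi of a ratio of densities\<close>

text \<open>This is psi(sqrt (a / b)) with numerator and denominator multiplied by
  \<open>sqrt b\<close>. The conventions at \<open>b = 0\<close> are built in: for
  \<open>a > 0\<close> it gives 1 = psi(infinity), and at \<open>a = b = 0\<close> the default value
  0 of a division by zero agrees with psi(1) = 0.\<close>

definition psi_ratio :: "real \<Rightarrow> real \<Rightarrow> real" where
  "psi_ratio a b = (sqrt a - sqrt b) / sqrt (a + b)"

lemma rho_psi_sqrt_ratio:
  assumes "0 \<le> a" "0 \<le> b" shows "rho_psi (sqrt_ratio a b) = psi_ratio a b"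
proof (cases "b = 0")
  case True
  then show ?thesis using assms by (auto simp: rho_psi_def sqrt_ratio_def psi_ratio_def)
next
  case False
  with assms have b: "b > 0" by simp
  have "sqrt (1 + a / b) = sqrt (a + b) / sqrt b"
    using b by (simp add: real_sqrt_divide[symmetric] field_simps)
  then show ?thesis using b assms
    by (simp add: rho_psi_def sqrt_ratio_def psi_ratio_def real_sqrt_divide field_simps)
qed

lemma psi_ratio_swap: "psi_ratio b a = - psi_ratio a b"
  by (simp add: psi_ratio_def add.commute minus_divide_left)

lemma psi_ratio_sq_le_1:
  assumes "0 \<le> a" "0 \<le> b" shows "(psi_ratio a b)\<^sup>2 \<le> 1"
proof -
  have "(sqrt a - sqrt b)\<^sup>2 \<le> a + b"
    using assms by (simp add: power2_diff)
  then show ?thesis using assms unfolding psi_ratio_def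
    by (auto simp: power_divide divide_le_eq_1)
qed

lemma abs_psi_ratio_le_1:
  assumes "0 \<le> a" "0 \<le> b" shows "\<bar>psi_ratio a b\<bar> \<le> 1"
  using psi_ratio_sq_le_1[OF assms] by (simp add: abs_square_le_1)

text \<open>For \<open>b > 0\<close> the value is a strictly increasing continuous function
  \<open>G\<close> of \<open>a / b\<close>, rising from -1 towards 1. Writing the threshold as
  \<open>a > \<kappa> * b\<close> rather than \<open>a / b > \<kappa>\<close> covers
  \<open>b = 0\<close> too. Level sets of psi thus become comparisons of one density with a multiple
  of the other.\<close>

lemma psi_ratio_gt_iff_threshold:
  assumes "0 < c" "c < 1"
  shows "\<exists>\<kappa>>0. \<forall>a b. 0 \<le> a \<longrightarrow> 0 \<le> b \<longrightarrow> (psi_ratio a b > c \<longleftrightarrow> a > \<kappa> * b)"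
proof -
  define G where "G u = sqrt (u / (u + 1)) - sqrt (1 / (u + 1))" for u :: real
  have G: "psi_ratio a b = G (a / b)" if "0 \<le> a" "0 < b" for a b
  proof -
    have "a / b / (a / b + 1) = a / (a + b)" "1 / (a / b + 1) = b / (a + b)"
      using that by (auto simp: field_simps add_nonneg_eq_0_iff)
    then have "G (a / b) = sqrt (a / (a + b)) - sqrt (b / (a + b))" unfolding G_def by (simp only:)
    then show ?thesis by (simp add: psi_ratio_def real_sqrt_divide diff_divide_distrib)
  qed
  have mono: "G u < G v" if "0 \<le> u" "u < v" for u v
  proof -
    have "u / (u + 1) < v / (v + 1)" "1 / (v + 1) < 1 / (u + 1)"
      using that by (auto simp: field_simps)
    then show ?thesis unfolding G_def by (smt (verit) real_sqrt_less_iff)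
  qed
  have "(G \<longlongrightarrow> 1) at_top" unfolding G_def by real_asymp
  then have "eventually (\<lambda>u. G u > c) at_top" using assms by (intro order_tendstoD) auto
  then obtain N where N: "\<And>u. u \<ge> N \<Longrightarrow> G u > c" by (auto simp: eventually_at_top_linorder)
  have "\<exists>x. 0 \<le> x \<and> x \<le> max N 0 \<and> G x = c"
  proof (rule IVT')
    show "G 0 \<le> c" using assms by (simp add: G_def)
    show "c \<le> G (max N 0)" using N[of "max N 0"] by simp
    show "continuous_on {0..max N 0} G" unfolding G_def
      by (intro continuous_intros) auto
  qed auto
  then obtain \<kappa> where k: "0 \<le> \<kappa>" "G \<kappa> = c" by auto
  have k0: "\<kappa> > 0" using k assms by (cases "\<kappa> = 0") (auto simp: G_def)
  have "psi_ratio a b > c \<longleftrightarrow> a > \<kappa> * b" if ab: "0 \<le> a" "0 \<le> b" for a b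
  proof (cases "b = 0")
    case True
    then show ?thesis using ab assms by (auto simp: psi_ratio_def)
  next
    case False
    then have b: "b > 0" using ab by simp
    have "G (a / b) > G \<kappa> \<longleftrightarrow> a / b > \<kappa>"
      using mono[of \<kappa> "a/b"] mono[of "a/b" \<kappa>] k ab b
      by (smt (verit, best) divide_nonneg_pos)
    then show ?thesis using G[OF ab(1) b] k b by (simp add: field_simps)
  qed
  then show ?thesis using k0 by blast
qed

section \<open>Stability of square roots of means and of psi\<close>

text \<open>Reverse triangle inequality for the Euclidean norms of \<open>(sqrt a, sqrt c)\<close>
  and \<open>(sqrt b, sqrt c)\<close>.\<close>

lemma sqrt_add_lipschitz:
  assumes "0 \<le> a" "0 \<le> b" "0 \<le> c"
  shows "\<bar>sqrt (a + c) - sqrt (b + c)\<bar> \<le> \<bar>sqrt a - sqrt b\<bar>"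
  using norm_triangle_ineq3[of "(sqrt a, sqrt c)" "(sqrt b, sqrt c)"] assms
  by (simp add: norm_Pair)

lemma sqrt_mean_lipschitz:
  assumes "0 \<le> a" "0 \<le> b" "0 \<le> c"
  shows "(sqrt ((a + c) / 2) - sqrt ((b + c) / 2))\<^sup>2 \<le> (sqrt a - sqrt b)\<^sup>2"
proof -
  have "(sqrt ((a + c) / 2) - sqrt ((b + c) / 2))\<^sup>2 = (sqrt (a + c) - sqrt (b + c))\<^sup>2 / 2"
    by (simp add: real_sqrt_divide power_divide diff_divide_distrib[symmetric])
  also have "\<dots> \<le> (sqrt (a + c) - sqrt (b + c))\<^sup>2" by simp
  also have "\<dots> \<le> (sqrt a - sqrt b)\<^sup>2"
    using sqrt_add_lipschitz[OF assms] by (simp add: abs_le_square_iff)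
  finally show ?thesis .
qed

text \<open>Numerator and denominator each move by at most
  \<open>\<bar>sqrt b - sqrt b'\<bar>\<close>, and the denominator is at least
  \<open>sqrt b\<close>. The bound is one-sided so that it survives \<open>b = 0\<close>, where the
  correction term is 0: then \<open>psi_ratio a b\<close> is the maximal value 1, or
  \<open>a = 0\<close> and the left side is at most 0.\<close>

lemma psi_ratio_perturb:
  assumes "0 \<le> a" "0 \<le> b" "0 \<le> b'"
  shows "psi_ratio a b' \<le> psi_ratio a b + 2 * \<bar>sqrt b - sqrt b'\<bar> / sqrt b"
proof (cases "b = 0")
  case True
  show ?thesis
  proof (cases "a = 0")
    case True
    then show ?thesis using \<open>b = 0\<close> assms by (simp add: psi_ratio_def)
  next
    case False
    then have "psi_ratio a b = 1" using True assms by (simp add: psi_ratio_def)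
    then show ?thesis using True abs_psi_ratio_le_1[OF assms(1,3)] by simp
  qed
next
  case False
  then have b: "b > 0" using assms by simp
  define R R' where "R = sqrt (a + b)" and "R' = sqrt (a + b')"
  have R: "R \<ge> sqrt b" "R > 0" using assms b by (auto simp: R_def)
  have lip: "\<bar>R - R'\<bar> \<le> \<bar>sqrt b - sqrt b'\<bar>"
    using sqrt_add_lipschitz[of b b' a] assms by (simp add: R_def R'_def add.commute)
  have 1: "\<bar>psi_ratio a b' * (R - R') / R\<bar> \<le> \<bar>sqrt b - sqrt b'\<bar> / R"
  proof -
    have "\<bar>psi_ratio a b'\<bar> * \<bar>R - R'\<bar> \<le> 1 * \<bar>sqrt b - sqrt b'\<bar>"
      by (intro mult_mono abs_psi_ratio_le_1 lip assms) auto
    then show ?thesis using R by (simp add: abs_mult divide_right_mono)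
  qed
  \<comment> \<open>Exact splitting into the effect of the numerator and that of the
    denominator.\<close>
  have "psi_ratio a b' = psi_ratio a b + (sqrt b - sqrt b') / R + psi_ratio a b' * (R - R') / R"
  proof -
    have "psi_ratio a b' * R' = sqrt a - sqrt b'" 
      using assms by (auto simp: psi_ratio_def R'_def add_nonneg_eq_0_iff)
    moreover have "psi_ratio a b * R = sqrt a - sqrt b" using R by (simp add: psi_ratio_def R_def)
    ultimately have "psi_ratio a b' * R = psi_ratio a b * R + (sqrt b - sqrt b') + psi_ratio a b' * (R - R')"
      by (simp add: algebra_simps)
    then have "psi_ratio a b' * R / R = (psi_ratio a b * R + (sqrt b - sqrt b') + psi_ratio a b' * (R - R')) / R" by simp
    then show ?thesis using R by (simp add: add_divide_distrib)
  qed
  moreover have "(sqrt b - sqrt b') / R \<le> \<bar>sqrt b - sqrt b'\<bar> / R" using R by (simp add: divide_right_mono)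
  moreover have "\<bar>sqrt b - sqrt b'\<bar> / R \<le> \<bar>sqrt b - sqrt b'\<bar> / sqrt b"
    using R b by (intro divide_left_mono) auto
  moreover have "psi_ratio a b' * (R - R') / R \<le> \<bar>sqrt b - sqrt b'\<bar> / R"
    using 1 abs_ge_self order_trans by blast
  ultimately have "psi_ratio a b' \<le> psi_ratio a b + \<bar>sqrt b - sqrt b'\<bar> / sqrt b + \<bar>sqrt b - sqrt b'\<bar> / sqrt b"
    by (intro ord_eq_le_trans[OF _ add_mono[OF add_mono[OF order_refl]]]) (assumption | (rule order_trans, assumption, assumption))+
  then show ?thesis by simp
qed

section \<open>Pointwise inequalities behind the second moment and the mean of the statistic\<close>

lemma power2_sum_le: "(x + y)\<^sup>2 \<le> 2 * x\<^sup>2 + 2 * (y::real)\<^sup>2"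
  using sum_squares_bound[of x y] by (simp add: power2_sum)

text \<open>Pointwise midpoint convexity of the squared Hellinger distance. After expanding the
  squares only the cross terms differ, and these compare by concavity of the square root.\<close>

lemma sqrt_mean_convex:
  assumes "0 \<le> s" "0 \<le> t" "0 \<le> u"
  shows "2 * (sqrt s - sqrt ((t + u) / 2))\<^sup>2 \<le> (sqrt s - sqrt t)\<^sup>2 + (sqrt s - sqrt u)\<^sup>2"
proof -
  have "(sqrt t + sqrt u) / 2 \<le> sqrt ((t + u) / 2)"
  proof (rule real_le_rsqrt)
    have "(sqrt t + sqrt u)\<^sup>2 + (sqrt t - sqrt u)\<^sup>2 = 2 * (t + u)"
      using assms by (simp add: power2_sum power2_diff)
    then have "(sqrt t + sqrt u)\<^sup>2 \<le> 2 * (t + u)"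
      using zero_le_power2[of "sqrt t - sqrt u"] by linarith
    then show "((sqrt t + sqrt u) / 2)\<^sup>2 \<le> (t + u) / 2"
      by (simp add: power_divide)
  qed
  then have "sqrt s * ((sqrt t + sqrt u) / 2) \<le> sqrt s * sqrt ((t + u) / 2)"
    using assms by (intro mult_left_mono) auto
  moreover have "(sqrt ((t + u) / 2))\<^sup>2 = (t + u) / 2" using assms by (intro real_sqrt_pow2) simp
  ultimately show ?thesis using assms
    by (simp add: power2_diff algebra_simps add_divide_distrib)
qed

text \<open>With \<open>r\<close> the mean of \<open>t\<close> and \<open>u\<close>,
  \<open>s\<close> is at most \<open>2 * (sqrt s - sqrt r)\<^sup>2 + 2 * r\<close>. On the first
  term psi is bounded by 1; on the second, \<open>2 * r = t + u\<close> cancels the denominator of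
  psi squared. The two terms contribute 1 and 2 to the constant 3.\<close>

lemma psi_ratio_sq_weighted_le:
  assumes "0 \<le> s" "0 \<le> t" "0 \<le> u"
  shows "(psi_ratio u t)\<^sup>2 * s \<le> 3 * ((sqrt s - sqrt t)\<^sup>2 + (sqrt s - sqrt u)\<^sup>2)"
proof -
  define r where "r = (t + u) / 2"
  have r: "0 \<le> r" using assms by (simp add: r_def)
  have "s \<le> 2 * (sqrt s - sqrt r)\<^sup>2 + 2 * r"
  proof -
    have "s = (sqrt s - sqrt r + sqrt r)\<^sup>2" using assms by simp
    also have "\<dots> \<le> 2 * (sqrt s - sqrt r)\<^sup>2 + 2 * (sqrt r)\<^sup>2" by (rule power2_sum_le)
    finally show ?thesis using r by simp
  qed
  then have "(psi_ratio u t)\<^sup>2 * s \<le> (psi_ratio u t)\<^sup>2 * (2 * (sqrt s - sqrt r)\<^sup>2 + 2 * r)"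
    by (intro mult_left_mono) auto
  also have "\<dots> = (psi_ratio u t)\<^sup>2 * (2 * (sqrt s - sqrt r)\<^sup>2) + (psi_ratio u t)\<^sup>2 * (2 * r)"
    by (rule distrib_left)
  also have "\<dots> \<le> 2 * (sqrt s - sqrt r)\<^sup>2 + (sqrt u - sqrt t)\<^sup>2"
  proof (intro add_mono)
    show "(psi_ratio u t)\<^sup>2 * (2 * (sqrt s - sqrt r)\<^sup>2) \<le> 2 * (sqrt s - sqrt r)\<^sup>2"
      using psi_ratio_sq_le_1[of u t] assms by (intro mult_left_le_one_le) auto
    show "(psi_ratio u t)\<^sup>2 * (2 * r) \<le> (sqrt u - sqrt t)\<^sup>2"
    proof (cases "u + t = 0")
      case True
      then show ?thesis using assms by (simp add: psi_ratio_def r_def)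
    next
      case False
      have "2 * r = u + t" by (simp add: r_def)
      with False show ?thesis using assms by (simp add: psi_ratio_def power_divide)
    qed
  qed
  also have "(sqrt u - sqrt t)\<^sup>2 \<le> 2 * (sqrt s - sqrt t)\<^sup>2 + 2 * (sqrt u - sqrt s)\<^sup>2"
    using power2_sum_le[of "sqrt s - sqrt t" "sqrt u - sqrt s"] by simp
  finally show ?thesis using sqrt_mean_convex[OF assms] by (simp add: r_def power2_commute[of "sqrt u" "sqrt s"])
qed

text \<open>Expanding psi times \<open>(sqrt s - sqrt r)\<^sup>2\<close> expresses psi times
  \<open>s\<close> through this square, a term in \<open>sqrt r\<close> that the two Hellinger terms
  cancel, and a term linear in \<open>sqrt s\<close> that is a difference of squares. Only the
  square is estimated, by psi at most 1 and convexity. The leftover \<open>(u - t) / 4\<close>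
  integrates to 0 for densities.\<close>

lemma rho_T_integrand_le:
  fixes s t u :: real
  assumes "0 \<le> s" "0 \<le> t" "0 \<le> u"
  shows "1/4 * (sqrt t - sqrt ((t + u) / 2))\<^sup>2 - 1/4 * (sqrt u - sqrt ((t + u) / 2))\<^sup>2
      + 1 / sqrt 2 * (psi_ratio u t * s)
    \<le> (1 + 1 / sqrt 2) / 2 * (sqrt s - sqrt t)\<^sup>2 - (1 - 1 / sqrt 2) / 2 * (sqrt s - sqrt u)\<^sup>2 + (u - t) / 4"
proof -
  define r where "r = (t + u) / 2"
  have r: "0 \<le> r" using assms by (simp add: r_def)
  \<comment> \<open>The denominator of psi is \<open>sqrt 2 * sqrt r\<close>; this is why the mean
    of \<open>t\<close> and \<open>u\<close> is the right centre for the expansion.\<close>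
  have psi_sqrt_mean: "psi_ratio u t * sqrt r = (sqrt u - sqrt t) / sqrt 2"
    using assms by (auto simp: psi_ratio_def r_def real_sqrt_divide add.commute add_nonneg_eq_0_iff)
  have "1 / sqrt 2 * psi_ratio u t * (sqrt s - sqrt r)\<^sup>2 \<le> 1 / sqrt 2 * (sqrt s - sqrt r)\<^sup>2"
    using abs_psi_ratio_le_1[of u t] assms by (intro mult_right_mono) (auto simp: field_simps)
  also have "\<dots> \<le> 1 / sqrt 2 * (((sqrt s - sqrt t)\<^sup>2 + (sqrt s - sqrt u)\<^sup>2) / 2)"
    using sqrt_mean_convex[OF assms] by (intro mult_left_mono) (auto simp: r_def)
  finally have 1: "1 / sqrt 2 * psi_ratio u t * (sqrt s - sqrt r)\<^sup>2
      \<le> 1 / sqrt 2 * (((sqrt s - sqrt t)\<^sup>2 + (sqrt s - sqrt u)\<^sup>2) / 2)" .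
  have 2: "1 / sqrt 2 * psi_ratio u t * (sqrt s - sqrt r)\<^sup>2
     = 1 / sqrt 2 * (psi_ratio u t * s) + (sqrt u - sqrt t) * sqrt r / 2 - sqrt s * (sqrt u - sqrt t)"
  proof -
    have "psi_ratio u t * (sqrt s - sqrt r)\<^sup>2 = psi_ratio u t * s + (psi_ratio u t * sqrt r) * sqrt r - 2 * sqrt s * (psi_ratio u t * sqrt r)"
      using assms r by (simp add: power2_eq_square algebra_simps)
    also have "\<dots> = psi_ratio u t * s + ((sqrt u - sqrt t) * sqrt r - 2 * sqrt s * (sqrt u - sqrt t)) / sqrt 2"
      unfolding psi_sqrt_mean by (simp add: diff_divide_distrib right_diff_distrib left_diff_distrib)
    finally have *: "psi_ratio u t * (sqrt s - sqrt r)\<^sup>2 = psi_ratio u t * s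
      + ((sqrt u - sqrt t) * sqrt r - 2 * sqrt s * (sqrt u - sqrt t)) / sqrt 2" .
    have "1 / sqrt 2 * psi_ratio u t * (sqrt s - sqrt r)\<^sup>2 = 1 / sqrt 2 * (psi_ratio u t * s)
      + (1 / sqrt 2 * (1 / sqrt 2)) * ((sqrt u - sqrt t) * sqrt r - 2 * sqrt s * (sqrt u - sqrt t))"
      unfolding mult.assoc * by (simp add: add_divide_distrib)
    also have "1 / sqrt 2 * (1 / sqrt 2) = (1/2::real)" by simp
    finally show ?thesis by (simp add: right_diff_distrib diff_divide_distrib left_diff_distrib)
  qed
  have 3: "1/4 * (sqrt t - sqrt r)\<^sup>2 - 1/4 * (sqrt u - sqrt r)\<^sup>2 = (t - u) / 4 + (sqrt u - sqrt t) * sqrt r / 2"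
    using assms by (simp add: power2_diff algebra_simps diff_divide_distrib)
  have 4: "(sqrt s - sqrt t)\<^sup>2 / 2 - (sqrt s - sqrt u)\<^sup>2 / 2 = sqrt s * (sqrt u - sqrt t) + (t - u) / 2"
    using assms by (simp add: power2_diff algebra_simps diff_divide_distrib add_divide_distrib)
  have 5: "(1 + 1 / sqrt 2) / 2 * (sqrt s - sqrt t)\<^sup>2 - (1 - 1 / sqrt 2) / 2 * (sqrt s - sqrt u)\<^sup>2
    = (sqrt s - sqrt t)\<^sup>2 / 2 - (sqrt s - sqrt u)\<^sup>2 / 2 + 1 / sqrt 2 * (((sqrt s - sqrt t)\<^sup>2 + (sqrt s - sqrt u)\<^sup>2) / 2)"
    by (simp add: algebra_simps add_divide_distrib diff_divide_distrib)
  have alg: "(t - u) / 4 + B + A \<le> C + (t - u) / 2 + E + (u - t) / 4" if "A + B - C \<le> E" for A B C E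
    using that by argo
  show ?thesis unfolding r_def[symmetric] using 1 unfolding 2 3 4 5 by (rule alg)
qed

section \<open>Hellinger distance and the expected test statistic\<close>

lemma densities_nonneg: "t \<in> densities \<Longrightarrow> 0 \<le> t x"
  by (simp add: densities_def)

lemma densities_measurable [measurable_dest]: "t \<in> densities \<Longrightarrow> t \<in> borel_measurable borel"
  by (simp add: densities_def)

lemma densities_has_bochner_integral: 
  assumes "t \<in> densities" shows "has_bochner_integral lborel t 1"
  using assms by (intro has_bochner_integral_nn_integral) (auto simp: densities_def)

lemma densities_integrable: "t \<in> densities \<Longrightarrow> integrable lborel t"
  using densities_has_bochner_integral by (auto simp: has_bochner_integral_iff)

lemma densities_integral: "t \<in> densities \<Longrightarrow> (\<integral>x. t x \<partial>lborel) = 1"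
  using densities_has_bochner_integral by (auto simp: has_bochner_integral_iff)

lemma mean_in_densities:
  assumes "t \<in> densities" "u \<in> densities" shows "(\<lambda>x. (t x + u x) / 2) \<in> densities"
proof -
  have i: "integrable lborel (\<lambda>x. (t x + u x) / 2)"
    using densities_integrable[OF assms(1)] densities_integrable[OF assms(2)] by simp
  have "(\<integral>x. (t x + u x) / 2 \<partial>lborel) = 1"
    using densities_integrable[OF assms(1)] densities_integrable[OF assms(2)]
      densities_integral[OF assms(1)] densities_integral[OF assms(2)] by simp
  then have "(\<integral>\<^sup>+x. ennreal ((t x + u x) / 2) \<partial>lborel) = 1"
    using i assms by (subst nn_integral_eq_integral) (auto simp: densities_nonneg)
  then show ?thesis using assms by (auto simp: densities_def)
qed

lemma integrable_hellinger:
  assumes "t \<in> densities" "u \<in> densities"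
  shows "integrable lborel (\<lambda>x. (sqrt (t x) - sqrt (u x))\<^sup>2)"
proof (rule Bochner_Integration.integrable_bound)
  show "integrable lborel (\<lambda>x. t x + u x)"
    using assms by (intro Bochner_Integration.integrable_add densities_integrable)
  show "(\<lambda>x. (sqrt (t x) - sqrt (u x))\<^sup>2) \<in> borel_measurable lborel"
    using assms by measurable
  show "AE x in lborel. norm ((sqrt (t x) - sqrt (u x))\<^sup>2) \<le> norm (t x + u x)"
  proof (rule AE_I2)
    fix x
    have "(sqrt (t x) - sqrt (u x))\<^sup>2 \<le> t x + u x"
      using assms by (simp add: power2_diff densities_nonneg)
    then show "norm ((sqrt (t x) - sqrt (u x))\<^sup>2) \<le> norm (t x + u x)"
      using assms by (simp add: densities_nonneg)
  qed
qed

lemma hellinger_sq: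
  assumes "t \<in> densities" "u \<in> densities"
  shows "(hellinger t u)\<^sup>2 = 1/2 * (\<integral>x. (sqrt (t x) - sqrt (u x))\<^sup>2 \<partial>lborel)"
  unfolding hellinger_def by (intro real_sqrt_pow2 mult_nonneg_nonneg integral_nonneg_AE) auto

lemma hellinger_sq_le_1:
  assumes "t \<in> densities" "u \<in> densities" shows "(hellinger t u)\<^sup>2 \<le> 1"
proof -
  have "(\<integral>x. (sqrt (t x) - sqrt (u x))\<^sup>2 \<partial>lborel) \<le> (\<integral>x. t x + u x \<partial>lborel)"
    using assms by (intro integral_mono integrable_hellinger Bochner_Integration.integrable_add densities_integrable)
      (auto simp: power2_diff densities_nonneg)
  also have "\<dots> = 2" using assms by (simp add: densities_integrable densities_integral)
  finally show ?thesis using hellinger_sq[OF assms] by simp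
qed

lemma hellinger_commute: "hellinger t u = hellinger u t"
  by (simp add: hellinger_def power2_commute)

lemma hellinger_sq_triangle:
  assumes "s \<in> densities" "t \<in> densities" "u \<in> densities"
  shows "(hellinger s u)\<^sup>2 \<le> 2 * (hellinger s t)\<^sup>2 + 2 * (hellinger t u)\<^sup>2"
proof -
  have "(\<integral>x. (sqrt (s x) - sqrt (u x))\<^sup>2 \<partial>lborel)
    \<le> (\<integral>x. 2 * (sqrt (s x) - sqrt (t x))\<^sup>2 + 2 * (sqrt (t x) - sqrt (u x))\<^sup>2 \<partial>lborel)"
    using assms power2_sum_le[of "sqrt (s x) - sqrt (t x)" "sqrt (t x) - sqrt (u x)" for x]
    by (intro integral_mono integrable_hellinger Bochner_Integration.integrable_add
      integrable_mult_right) auto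
  then show ?thesis using assms by (simp add: hellinger_sq integrable_hellinger)
qed

lemma psi_ratio_measurable [measurable]:
  assumes [measurable]: "f \<in> borel_measurable M" "g \<in> borel_measurable M"
  shows "(\<lambda>x. psi_ratio (f x) (g x)) \<in> borel_measurable M"
  unfolding psi_ratio_def by measurable

lemma integrable_psi_ratio:
  assumes "s \<in> densities" "t \<in> densities" "u \<in> densities"
  shows "integrable lborel (\<lambda>x. psi_ratio (u x) (t x) * s x)" "integrable lborel (\<lambda>x. (psi_ratio (u x) (t x))\<^sup>2 * s x)"
proof -
  show "integrable lborel (\<lambda>x. psi_ratio (u x) (t x) * s x)"
  proof (rule Bochner_Integration.integrable_bound[OF densities_integrable[OF assms(1)]])
    show "(\<lambda>x. psi_ratio (u x) (t x) * s x) \<in> borel_measurable lborel" using assms by measurable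
    show "AE x in lborel. norm (psi_ratio (u x) (t x) * s x) \<le> norm (s x)"
      using abs_psi_ratio_le_1[OF densities_nonneg[OF assms(3)] densities_nonneg[OF assms(2)]]
      by (auto simp: abs_mult intro!: mult_left_le_one_le)
  qed
  show "integrable lborel (\<lambda>x. (psi_ratio (u x) (t x))\<^sup>2 * s x)"
  proof (rule Bochner_Integration.integrable_bound[OF densities_integrable[OF assms(1)]])
    show "(\<lambda>x. (psi_ratio (u x) (t x))\<^sup>2 * s x) \<in> borel_measurable lborel" using assms by measurable
    show "AE x in lborel. norm ((psi_ratio (u x) (t x))\<^sup>2 * s x) \<le> norm (s x)"
      using psi_ratio_sq_le_1[OF densities_nonneg[OF assms(3)] densities_nonneg[OF assms(2)]]
      by (auto simp: abs_mult intro!: mult_left_le_one_le)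
  qed
qed

text \<open>The 6 is the pointwise constant 3 times the 2 that undoes the factor 1/2 in
  \<open>hellinger\<close>. This bound lets a small multiple of the second moment be absorbed by the
  mean.\<close>

lemma psi_ratio_second_moment_le:
  assumes "s \<in> densities" "t \<in> densities" "u \<in> densities"
  shows "(\<integral>x. (psi_ratio (u x) (t x))\<^sup>2 * s x \<partial>lborel) \<le> 6 * ((hellinger s t)\<^sup>2 + (hellinger s u)\<^sup>2)"
proof -
  have "(\<integral>x. (psi_ratio (u x) (t x))\<^sup>2 * s x \<partial>lborel)
    \<le> (\<integral>x. 3 * ((sqrt (s x) - sqrt (t x))\<^sup>2 + (sqrt (s x) - sqrt (u x))\<^sup>2) \<partial>lborel)"
    using assms by (intro integral_mono integrable_psi_ratio integrable_hellinger Bochner_Integration.integrable_add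
      integrable_mult_right psi_ratio_sq_weighted_le densities_nonneg) auto
  then show ?thesis using assms by (simp add: hellinger_sq integrable_hellinger)
qed

text \<open>The left side is the expectation of the statistic per observation. The coefficient
  \<open>1 - 1 / sqrt 2\<close> is positive, so the mean of the statistic drifts downwards as
  \<open>u\<close> moves away from \<open>s\<close>.\<close>

lemma rho_T_expectation_le:
  assumes "s \<in> densities" "t \<in> densities" "u \<in> densities"
  shows "1/2 * ((hellinger t (\<lambda>x. (t x + u x) / 2))\<^sup>2 - (hellinger u (\<lambda>x. (t x + u x) / 2))\<^sup>2)
      + 1 / sqrt 2 * (\<integral>x. psi_ratio (u x) (t x) * s x \<partial>lborel)
    \<le> (1 + 1 / sqrt 2) * (hellinger s t)\<^sup>2 - (1 - 1 / sqrt 2) * (hellinger s u)\<^sup>2"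
proof -
  note r = mean_in_densities[OF assms(2,3)]
  note i = integrable_hellinger[OF assms(2) r] integrable_hellinger[OF assms(3) r]
    integrable_hellinger[OF assms(1,2)] integrable_hellinger[OF assms(1,3)]
    integrable_psi_ratio(1)[OF assms] densities_integrable[OF assms(2)] densities_integrable[OF assms(3)]
  let ?L = "\<lambda>x. 1/4 * (sqrt (t x) - sqrt ((t x + u x) / 2))\<^sup>2 - 1/4 * (sqrt (u x) - sqrt ((t x + u x) / 2))\<^sup>2
      + 1 / sqrt 2 * (psi_ratio (u x) (t x) * s x)"
  let ?R = "\<lambda>x. (1 + 1 / sqrt 2) / 2 * (sqrt (s x) - sqrt (t x))\<^sup>2
      - (1 - 1 / sqrt 2) / 2 * (sqrt (s x) - sqrt (u x))\<^sup>2 + (u x - t x) / 4"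
  have le: "integral\<^sup>L lborel ?L \<le> integral\<^sup>L lborel ?R"
  proof (rule integral_mono)
    show "integrable lborel ?L"
      by (intro Bochner_Integration.integrable_add Bochner_Integration.integrable_diff integrable_mult_right i)
    show "integrable lborel ?R"
      by (intro Bochner_Integration.integrable_add Bochner_Integration.integrable_diff integrable_mult_right
         integrable_divide i)
    show "?L x \<le> ?R x" for x
      by (rule rho_T_integrand_le) (use assms in \<open>auto simp: densities_nonneg\<close>)
  qed
  have L: "integral\<^sup>L lborel ?L = 1/4 * (\<integral>x. (sqrt (t x) - sqrt ((t x + u x) / 2))\<^sup>2 \<partial>lborel)
     - 1/4 * (\<integral>x. (sqrt (u x) - sqrt ((t x + u x) / 2))\<^sup>2 \<partial>lborel) + 1 / sqrt 2 * (\<integral>x. psi_ratio (u x) (t x) * s x \<partial>lborel)"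
    by (subst Bochner_Integration.integral_add Bochner_Integration.integral_diff,
        (intro Bochner_Integration.integrable_diff integrable_mult_right i)+)+
       (simp only: integral_mult_right_zero)
  have R: "integral\<^sup>L lborel ?R = (1 + 1 / sqrt 2) / 2 * (\<integral>x. (sqrt (s x) - sqrt (t x))\<^sup>2 \<partial>lborel)
     - (1 - 1 / sqrt 2) / 2 * (\<integral>x. (sqrt (s x) - sqrt (u x))\<^sup>2 \<partial>lborel)"
    using densities_integral[OF assms(2)] densities_integral[OF assms(3)]
    by (subst Bochner_Integration.integral_add Bochner_Integration.integral_diff,
        (intro Bochner_Integration.integrable_diff integrable_mult_right integrable_divide i)+)+
       (simp add: i)
  have "1/2 * (1/2 * A - 1/2 * B) + w * R \<le> (1 + w) * (1/2 * S) - (1 - w) * (1/2 * T)"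
    if "1/4 * A - 1/4 * B + w * R \<le> (1 + w) / 2 * S - (1 - w) / 2 * T" for A B R S T w :: real
    using that by (simp add: algebra_simps)
  note alg = this
  show ?thesis
    unfolding hellinger_sq[OF assms(2) r] hellinger_sq[OF assms(3) r] hellinger_sq[OF assms(1,2)]
       hellinger_sq[OF assms(1,3)] by (rule alg) (use le L R in \<open>simp only:\<close>)
qed

section \<open>Approximation inside a dense subset\<close>

text \<open>Young's inequality for the cross term \<open>2 * v * (u - v)\<close>, with weight
  \<open>\<eta>\<close>; for small \<open>\<eta>\<close> the leading factor is close to 1.\<close>

lemma power2_young:
  fixes u v \<eta> :: real
  assumes "\<eta> > 0" shows "u\<^sup>2 \<le> (1 + \<eta>) * v\<^sup>2 + (1 + 1 / \<eta>) * (u - v)\<^sup>2"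
proof -
  have "0 \<le> (sqrt \<eta> * v - (u - v) / sqrt \<eta>)\<^sup>2" by simp
  also have "\<dots> = \<eta> * v\<^sup>2 + (u - v)\<^sup>2 / \<eta> - 2 * v * (u - v)"
    using assms by (simp add: power2_diff power_mult_distrib power_divide)
  finally have "2 * v * (u - v) \<le> \<eta> * v\<^sup>2 + (u - v)\<^sup>2 / \<eta>" by simp
  moreover have "u\<^sup>2 = v\<^sup>2 + (u - v)\<^sup>2 + 2 * v * (u - v)" by (simp add: power2_eq_square algebra_simps)
  ultimately show ?thesis by (simp add: distrib_right)
qed

text \<open>The bound is uniform in \<open>u\<close>, which is what makes the approximation of a point of the model by
  points of a dense subset compatible with the supremum defining the \<open>\<rho>\<close>-estimator.\<close>

lemma hellinger_mean_perturb:
  assumes t: "t \<in> densities" and t': "t' \<in> densities" and u: "u \<in> densities" and "\<eta> > 0"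
  shows "(hellinger t' (\<lambda>x. (t' x + u x) / 2))\<^sup>2 - (hellinger u (\<lambda>x. (t' x + u x) / 2))\<^sup>2
    \<le> (hellinger t (\<lambda>x. (t x + u x) / 2))\<^sup>2 - (hellinger u (\<lambda>x. (t x + u x) / 2))\<^sup>2
      + 2 * \<eta> + 5 * (1 + 1 / \<eta>) * (hellinger t t')\<^sup>2"
proof -
  define r r' where "r = (\<lambda>x. (t x + u x) / 2)" and "r' = (\<lambda>x. (t' x + u x) / 2)"
  have r: "r \<in> densities" "r' \<in> densities" using t t' u by (auto simp: r_def r'_def mean_in_densities)
  note nn = densities_nonneg[OF t] densities_nonneg[OF t'] densities_nonneg[OF u]
  have lip: "(sqrt (r x) - sqrt (r' x))\<^sup>2 \<le> (sqrt (t x) - sqrt (t' x))\<^sup>2" for x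
    unfolding r_def r'_def by (rule sqrt_mean_lipschitz) (rule nn)+
  \<comment> \<open>Integrated Young inequality in the form needed twice below; \<open>k\<close>
    compares the pointwise change with the change from \<open>t\<close> to
    \<open>t'\<close>.\<close>
  have int: "integral\<^sup>L lborel (\<lambda>x. (sqrt (a x) - sqrt (b x))\<^sup>2)
      \<le> (1 + \<eta>) * integral\<^sup>L lborel (\<lambda>x. (sqrt (c x) - sqrt (d x))\<^sup>2)
       + (1 + 1 / \<eta>) * (k * integral\<^sup>L lborel (\<lambda>x. (sqrt (t x) - sqrt (t' x))\<^sup>2))"
    if "a \<in> densities" "b \<in> densities" "c \<in> densities" "d \<in> densities"
      "\<And>x. ((sqrt (a x) - sqrt (b x)) - (sqrt (c x) - sqrt (d x)))\<^sup>2 \<le> k * (sqrt (t x) - sqrt (t' x))\<^sup>2"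
    for a b c d k
  proof -
    have "integral\<^sup>L lborel (\<lambda>x. (sqrt (a x) - sqrt (b x))\<^sup>2)
      \<le> integral\<^sup>L lborel (\<lambda>x. (1 + \<eta>) * (sqrt (c x) - sqrt (d x))\<^sup>2 + (1 + 1 / \<eta>) * (k * (sqrt (t x) - sqrt (t' x))\<^sup>2))"
    proof (rule integral_mono)
      show "(sqrt (a x) - sqrt (b x))\<^sup>2 \<le> (1 + \<eta>) * (sqrt (c x) - sqrt (d x))\<^sup>2 + (1 + 1 / \<eta>) * (k * (sqrt (t x) - sqrt (t' x))\<^sup>2)" for x
      proof -
        have "(1 + 1 / \<eta>) * ((sqrt (a x) - sqrt (b x)) - (sqrt (c x) - sqrt (d x)))\<^sup>2
            \<le> (1 + 1 / \<eta>) * (k * (sqrt (t x) - sqrt (t' x))\<^sup>2)"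
          using \<open>\<eta> > 0\<close> by (intro mult_left_mono that) auto
        then show ?thesis
          using power2_young[OF \<open>\<eta> > 0\<close>, of "sqrt (a x) - sqrt (b x)" "sqrt (c x) - sqrt (d x)"] by linarith
      qed
    qed (intro Bochner_Integration.integrable_add integrable_mult_right integrable_hellinger that t t')+
    also have "\<dots> = (1 + \<eta>) * integral\<^sup>L lborel (\<lambda>x. (sqrt (c x) - sqrt (d x))\<^sup>2)
       + (1 + 1 / \<eta>) * (k * integral\<^sup>L lborel (\<lambda>x. (sqrt (t x) - sqrt (t' x))\<^sup>2))"
      by (subst Bochner_Integration.integral_add)
         (intro integrable_mult_right integrable_hellinger that t t' | simp only: integral_mult_right_zero)+
    finally show ?thesis .
  qed
  \<comment> \<open>Here both the density and the mean move, which costs the factor 4; in the next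
    comparison only the mean moves, with factor 1. Together they give the 5.\<close>
  have 1: "(hellinger t' r')\<^sup>2 \<le> (1 + \<eta>) * (hellinger t r)\<^sup>2 + (1 + 1 / \<eta>) * (4 * (hellinger t t')\<^sup>2)"
  proof -
    have "((sqrt (t' x) - sqrt (r' x)) - (sqrt (t x) - sqrt (r x)))\<^sup>2 \<le> 4 * (sqrt (t x) - sqrt (t' x))\<^sup>2" for x
      using power2_sum_le[of "sqrt (t' x) - sqrt (t x)" "sqrt (r x) - sqrt (r' x)"] lip[of x]
      by (simp add: power2_commute algebra_simps)
    from int[OF t' r(2) t r(1) this] show ?thesis
      by (simp add: hellinger_sq t t' r)
  qed
  have 2: "(hellinger u r)\<^sup>2 \<le> (1 + \<eta>) * (hellinger u r')\<^sup>2 + (1 + 1 / \<eta>) * (1 * (hellinger t t')\<^sup>2)"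
  proof -
    have "((sqrt (u x) - sqrt (r x)) - (sqrt (u x) - sqrt (r' x)))\<^sup>2 \<le> 1 * (sqrt (t x) - sqrt (t' x))\<^sup>2" for x
      using lip[of x] by (simp add: power2_commute)
    from int[OF u r(1) u r(2) this] show ?thesis
      by (simp add: hellinger_sq t t' u r)
  qed
  \<comment> \<open>Squared distances are at most 1, so each relative error \<open>\<eta>\<close> is
    also an absolute one.\<close>
  have "\<eta> * (hellinger t r)\<^sup>2 \<le> \<eta>" "\<eta> * (hellinger u r')\<^sup>2 \<le> \<eta>"
    using hellinger_sq_le_1[OF t r(1)] hellinger_sq_le_1[OF u r(2)] \<open>\<eta> > 0\<close> by auto
  then show ?thesis using 1 2 unfolding r_def[symmetric] r'_def[symmetric] by (simp add: algebra_simps)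
qed

section \<open>The test statistic on densities and its near minimizers\<close>

lemma rho_T_psi_ratio:
  assumes "t \<in> densities" "u \<in> densities"
  shows "rho_T n X t u =
     real n / 2 * ((hellinger t (\<lambda>x. (t x + u x) / 2))\<^sup>2 - (hellinger u (\<lambda>x. (t x + u x) / 2))\<^sup>2)
     + 1 / sqrt 2 * (\<Sum>i\<in>{1..n}. psi_ratio (u (X i)) (t (X i)))"
  using assms by (simp add: rho_T_def rho_psi_sqrt_ratio densities_nonneg)

lemma rho_T_swap:
  assumes "t \<in> densities" "u \<in> densities"
  shows "rho_T n X u t = - rho_T n X t u"
proof -
  have "(\<Sum>i\<in>{1..n}. psi_ratio (t (X i)) (u (X i))) = - (\<Sum>i\<in>{1..n}. psi_ratio (u (X i)) (t (X i)))"
    by (simp add: sum_negf[symmetric] psi_ratio_swap[of "t _"])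
  then show ?thesis using assms by (simp add: rho_T_psi_ratio add.commute algebra_simps)
qed

text \<open>Boundedness gives the real-valued \<open>SUP\<close> and \<open>INF\<close> in the
  definition of the estimator their usual meaning; a crude constant suffices.\<close>

lemma abs_rho_T_le:
  assumes "t \<in> densities" "u \<in> densities"
  shows "\<bar>rho_T n X t u\<bar> \<le> 2 * real n"
proof -
  define A where "A = (hellinger t (\<lambda>x. (t x + u x) / 2))\<^sup>2"
  define B where "B = (hellinger u (\<lambda>x. (t x + u x) / 2))\<^sup>2"
  have "A \<le> 1" "B \<le> 1" "0 \<le> A" "0 \<le> B" using assms mean_in_densities[OF assms]
    by (auto simp: A_def B_def hellinger_sq_le_1)
  then have "\<bar>A - B\<bar> \<le> 1" by linarith
  then have 1: "\<bar>real n / 2 * (A - B)\<bar> \<le> real n / 2 * 1" unfolding abs_mult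
    by (intro mult_mono) auto
  have "\<bar>\<Sum>i\<in>{1..n}. psi_ratio (u (X i)) (t (X i))\<bar> \<le> (\<Sum>i\<in>{1..n}. 1)"
    using assms by (intro order_trans[OF sum_abs] sum_mono abs_psi_ratio_le_1) (auto simp: densities_nonneg)
  then have 2: "\<bar>1 / sqrt 2 * (\<Sum>i\<in>{1..n}. psi_ratio (u (X i)) (t (X i)))\<bar> \<le> 1 * real n" unfolding abs_mult
    by (intro mult_mono) auto
  have "\<bar>rho_T n X t u\<bar> \<le> \<bar>real n / 2 * (A - B)\<bar> + \<bar>1 / sqrt 2 * (\<Sum>i\<in>{1..n}. psi_ratio (u (X i)) (t (X i)))\<bar>"
    unfolding rho_T_psi_ratio[OF assms] A_def B_def by (rule abs_triangle_ineq)
  then show ?thesis using 1 2 by simp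
qed

text \<open>By antisymmetry \<open>- rho_T n X t v = rho_T n X v t\<close>, which is at most the
  criterion at \<open>v\<close>. Near minimality bounds this by the criterion at \<open>t\<close>
  plus 35.7, and the criterion at \<open>t\<close> is at most \<open>b\<close>.\<close>

lemma rho_minimizer_bound:
  assumes S: "S \<subseteq> densities" and t: "t \<in> S" and v: "v \<in> rho_minimizers n X S"
    and b: "\<And>u. u \<in> S \<Longrightarrow> rho_T n X t u \<le> b"
  shows "0 \<le> rho_T n X t v + b + 35.7"
proof -
  have v': "v \<in> S" using v by (simp add: rho_minimizers_def)
  have bdd: "bdd_above ((\<lambda>u. rho_T n X w u) ` S)" if "w \<in> S" for w
    using abs_rho_T_le[of w _ n X] that S by (intro bdd_aboveI2[of _ _ "2 * real n"]) (fastforce simp: abs_le_iff)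
  have low: "- (2 * real n) \<le> rho_Upsilon n X S w" if "w \<in> S" for w
  proof -
    have "- (2 * real n) \<le> rho_T n X w w" using abs_rho_T_le[of w w n X] that S by (auto simp: abs_le_iff)
    also have "\<dots> \<le> rho_Upsilon n X S w" unfolding rho_Upsilon_def
      by (rule cSUP_upper[OF that bdd[OF that]])
    finally show ?thesis .
  qed
  have "rho_T n X v t \<le> rho_Upsilon n X S v" unfolding rho_Upsilon_def by (rule cSUP_upper[OF t bdd[OF v']])
  also have "\<dots> \<le> (INF w\<in>S. rho_Upsilon n X S w) + 35.7" using v by (simp add: rho_minimizers_def)
  also have "(INF w\<in>S. rho_Upsilon n X S w) \<le> rho_Upsilon n X S t"
    by (rule cINF_lower[OF bdd_belowI2[OF low] t])
  also have "\<dots> \<le> b" unfolding rho_Upsilon_def using t b by (intro cSUP_least) auto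
  finally show ?thesis using rho_T_swap[of t v n X] S t v' by (simp add: subset_iff)
qed

text \<open>Hellinger convergence is L2 convergence of square roots, hence almost everywhere
  convergence along a subsequence.\<close>

lemma dense_AE_subsequence:
  assumes S: "S \<subseteq> densities" and t: "t \<in> hellinger_closure S"
  obtains f where "\<And>k::nat. f k \<in> S" "(\<lambda>k. (hellinger t (f k))\<^sup>2) \<longlonglongrightarrow> 0"
    "AE x in lborel. (\<lambda>k. sqrt (f k x) - sqrt (t x)) \<longlonglongrightarrow> 0"
proof -
  have td: "t \<in> densities" using t by (simp add: hellinger_closure_def)
  have "\<exists>u\<in>S. hellinger t u < 1 / real (Suc k)" for k
    using t unfolding hellinger_closure_def by (simp del: of_nat_Suc)
  then obtain f where f: "f k \<in> S" "hellinger t (f k) < 1 / real (Suc k)" for k by metis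
  have fd: "f k \<in> densities" for k using f S by auto
  have h: "(\<lambda>k. (hellinger t (f k))\<^sup>2) \<longlonglongrightarrow> 0"
  proof -
    have "(\<lambda>k. hellinger t (f k)) \<longlonglongrightarrow> 0"
    proof (rule tendsto_sandwich[OF _ _ tendsto_const LIMSEQ_inverse_real_of_nat])
      show "eventually (\<lambda>k. 0 \<le> hellinger t (f k)) sequentially"
        by (auto simp: hellinger_def intro!: integral_nonneg_AE)
      show "eventually (\<lambda>k. hellinger t (f k) \<le> inverse (real (Suc k))) sequentially"
        using f(2) by (intro always_eventually allI less_imp_le) (simp add: divide_inverse del: of_nat_Suc)
    qed
    from tendsto_power[OF this, of 2] show ?thesis by simp
  qed
  have "(\<lambda>k. \<integral>x. norm ((sqrt (f k x) - sqrt (t x))\<^sup>2) \<partial>lborel) \<longlonglongrightarrow> 0"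
    using tendsto_mult_right_zero[OF h, of 2] by (simp add: hellinger_sq[OF td fd] power2_commute)
  from tendsto_L1_AE_subseq[OF integrable_hellinger[OF fd td] this] obtain r where
    r: "strict_mono r" "AE x in lborel. (\<lambda>k. (sqrt (f (r k) x) - sqrt (t x))\<^sup>2) \<longlonglongrightarrow> 0" by auto
  show ?thesis
  proof (rule that[of "f \<circ> r"])
    show "(\<lambda>k. (hellinger t ((f \<circ> r) k))\<^sup>2) \<longlonglongrightarrow> 0"
      using LIMSEQ_subseq_LIMSEQ[OF h r(1)] by (simp add: o_def)
    show "AE x in lborel. (\<lambda>k. sqrt ((f \<circ> r) k x) - sqrt (t x)) \<longlonglongrightarrow> 0"
      using r(2) by eventually_elim simp
  qed (use f in auto)
qed

text \<open>Replacing \<open>t\<close> by \<open>f k\<close> changes the statistic against any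
  \<open>u\<close> by at most an error free of \<open>u\<close>, which can be made small at the
  observed points. The exceptional null set comes from the sequence \<open>f\<close> alone, so the
  quantifiers over \<open>v\<close> and \<open>b\<close> stand inside \<open>AE\<close>.\<close>

lemma rho_minimizer_bound_closure:
  assumes S: "S \<subseteq> densities" and t: "t \<in> hellinger_closure S" and s: "s \<in> densities"
  shows "AE X in iid_sample n s. \<forall>v\<in>rho_minimizers n X S. \<forall>b. (\<forall>u\<in>S. rho_T n X t u \<le> b) \<longrightarrow>
    0 \<le> rho_T n X t v + b + 35.7"
proof -
  obtain f where f: "\<And>k::nat. f k \<in> S" "(\<lambda>k. (hellinger t (f k))\<^sup>2) \<longlonglongrightarrow> 0"
    "AE x in lborel. (\<lambda>k. sqrt (f k x) - sqrt (t x)) \<longlonglongrightarrow> 0"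
    using dense_AE_subsequence[OF S t] by blast
  have td: "t \<in> densities" using t by (simp add: hellinger_closure_def)
  have fd: "f k \<in> densities" for k using f S by auto
  have [measurable]: "s \<in> borel_measurable borel" using s by (rule densities_measurable)
  have P: "prob_space (density lborel (\<lambda>x. ennreal (s x)))"
    using s by (intro prob_spaceI) (simp add: emeasure_density densities_def)
  have ae: "AE x in density lborel (\<lambda>x. ennreal (s x)). (\<lambda>k. sqrt (f k x) - sqrt (t x)) \<longlonglongrightarrow> 0"
    using f(3) by (simp add: AE_density) (auto elim: eventually_mono)
  have "AE X in iid_sample n s. \<forall>i\<in>{1..n}. (\<lambda>k. sqrt (f k (X i)) - sqrt (t (X i))) \<longlonglongrightarrow> 0"
    unfolding iid_sample_def
    by (intro AE_finite_allI AE_PiM_component[where M = "\<lambda>_. density lborel (\<lambda>x. ennreal (s x))"] P ae) auto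
  then show ?thesis
  proof eventually_elim
    case (elim X)
    show ?case
    proof (intro ballI allI impI)
      fix v b assume v: "v \<in> rho_minimizers n X S" and b: "\<forall>u\<in>S. rho_T n X t u \<le> b"
      have v': "v \<in> S" using v by (simp add: rho_minimizers_def)
      show "0 \<le> rho_T n X t v + b + 35.7"
      proof (rule field_le_epsilon)
        fix e :: real assume e: "e > 0"
        \<comment> \<open>The Young error contributes \<open>real n * \<eta>\<close> in the limit,
          which this choice keeps at most \<open>e / 4\<close>. Of the tolerance,
          \<open>e / 2\<close> is then spent on the bound \<open>b\<close> and \<open>e / 2\<close>
          on the value at \<open>v\<close>.\<close>
        define \<eta> where "\<eta> = e / (4 * (real n + 1))"
        have \<eta>: "\<eta> > 0" using e by (simp add: \<eta>_def)
        define err where "err k = real n / 2 * (2 * \<eta> + 5 * (1 + 1 / \<eta>) * (hellinger t (f k))\<^sup>2)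
          + 1 / sqrt 2 * (\<Sum>i\<in>{1..n}. 2 * \<bar>sqrt (t (X i)) - sqrt (f k (X i))\<bar> / sqrt (t (X i)))" for k
        have le: "rho_T n X (f k) u \<le> rho_T n X t u + err k" if "u \<in> S" for u k
        proof -
          have u: "u \<in> densities" using that S by auto
          have "(\<Sum>i\<in>{1..n}. psi_ratio (u (X i)) (f k (X i)))
             \<le> (\<Sum>i\<in>{1..n}. psi_ratio (u (X i)) (t (X i)) + 2 * \<bar>sqrt (t (X i)) - sqrt (f k (X i))\<bar> / sqrt (t (X i)))"
            by (intro sum_mono psi_ratio_perturb densities_nonneg u td fd)
          then have 1: "1 / sqrt 2 * (\<Sum>i\<in>{1..n}. psi_ratio (u (X i)) (f k (X i)))
             \<le> 1 / sqrt 2 * ((\<Sum>i\<in>{1..n}. psi_ratio (u (X i)) (t (X i))) + (\<Sum>i\<in>{1..n}. 2 * \<bar>sqrt (t (X i)) - sqrt (f k (X i))\<bar> / sqrt (t (X i))))"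
            unfolding sum.distrib by (intro mult_left_mono) auto
          have 2: "real n / 2 * ((hellinger (f k) (\<lambda>x. (f k x + u x) / 2))\<^sup>2 - (hellinger u (\<lambda>x. (f k x + u x) / 2))\<^sup>2)
            \<le> real n / 2 * ((hellinger t (\<lambda>x. (t x + u x) / 2))\<^sup>2 - (hellinger u (\<lambda>x. (t x + u x) / 2))\<^sup>2
      + 2 * \<eta> + 5 * (1 + 1 / \<eta>) * (hellinger t (f k))\<^sup>2)"
            by (intro mult_left_mono hellinger_mean_perturb td fd u \<eta>) auto
          show ?thesis unfolding rho_T_psi_ratio[OF td u] rho_T_psi_ratio[OF fd u] err_def using 1 2
            by (simp only: distrib_left)
        qed
        have "err \<longlonglongrightarrow> real n / 2 * (2 * \<eta> + 5 * (1 + 1 / \<eta>) * 0)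
          + 1 / sqrt 2 * (\<Sum>i\<in>{1..n}. 2 * \<bar>- 0\<bar> / sqrt (t (X i)))"
        proof -
          \<comment> \<open>At a point where \<open>t\<close> vanishes the quotient is constantly 0
            by the division convention.\<close>
          have "(\<lambda>k. 2 * \<bar>- (sqrt (f k (X i)) - sqrt (t (X i)))\<bar> / sqrt (t (X i))) \<longlonglongrightarrow> 2 * \<bar>- 0\<bar> / sqrt (t (X i))"
            if "i \<in> {1..n}" for i
          proof (cases "t (X i) = 0")
            case False
            then show ?thesis using elim that by (intro tendsto_intros) auto
          qed simp
          then show ?thesis unfolding err_def
            by (intro tendsto_add tendsto_mult tendsto_const tendsto_sum f(2)) simp
        qed
        then have "err \<longlonglongrightarrow> real n * \<eta>" by simp
        moreover have "real n * \<eta> < e / 2"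
        proof -
          have "real n * \<eta> = e / 4 * (real n / (real n + 1))" by (simp add: \<eta>_def)
          also have "\<dots> \<le> e / 4 * 1" using e by (intro mult_left_mono) auto
          finally show ?thesis using e by simp
        qed
        ultimately have "eventually (\<lambda>k. err k < e / 2) sequentially" by (rule order_tendstoD)
        then obtain k where k: "err k < e / 2" by (auto simp: eventually_sequentially)
        have "0 \<le> rho_T n X (f k) v + (b + e / 2) + 35.7"
        proof (rule rho_minimizer_bound[OF S f(1) v])
          show "rho_T n X (f k) u \<le> b + e / 2" if "u \<in> S" for u using le[OF that, of k] b that k by force
        qed
        then show "0 \<le> rho_T n X t v + b + 35.7 + e" using le[OF v', of k] k by simp
      qed
    qed
  qed
qed

section \<open>Quantile grids and unions of intervals\<close>

definition law :: "(real \<Rightarrow> real) \<Rightarrow> real measure" where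
  "law s = density lborel (\<lambda>x. ennreal (s x))"

lemma sets_law [simp, measurable_cong]: "sets (law s) = sets borel"
  by (simp add: law_def)

lemma space_law [simp]: "space (law s) = UNIV"
  by (simp add: law_def)

lemma prob_space_law: "s \<in> densities \<Longrightarrow> prob_space (law s)"
  by (intro prob_spaceI) (auto simp: law_def emeasure_density densities_def)

text \<open>The law has no atoms, so the left endpoint carries no mass.\<close>

lemma measure_law_atLeastAtMost:
  assumes "s \<in> densities" "a \<le> b"
  shows "measure (law s) {a..b} = measure (law s) {..b} - measure (law s) {..a}"
proof -
  interpret prob_space "law s" by (rule prob_space_law) fact
  have [measurable]: "s \<in> borel_measurable borel" using assms by (simp add: densities_measurable)
  have "AE x in lborel. x \<noteq> a" by (rule AE_lborel_singleton)
  then have "AE x in law s. x \<noteq> a" unfolding law_def by (subst AE_density) (auto elim: eventually_mono)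
  then have ae: "AE x in law s. x \<in> {a..b} \<longleftrightarrow> x \<in> {..b} - {..a}"
    by eventually_elim auto
  have "measure (law s) {a..b} = measure (law s) ({..b} - {..a})"
    by (rule measure_eq_AE[OF ae]) auto
  also have "\<dots> = measure (law s) {..b} - measure (law s) {..a}"
    using assms by (intro finite_measure_Diff) auto
  finally show ?thesis .
qed

text \<open>By inner regularity it is enough to bound compact subsets, and a compact set lies in the
  segment between its minimum and maximum, both points of \<open>K\<close>. This bounds grid cells
  whatever the shape of their ends.\<close>

lemma measure_le_of_segments:
  fixes P :: "real measure"
  assumes "finite_measure P" "sets P = sets borel" and K: "K \<in> sets borel" and "0 \<le> c"
    and seg: "\<And>a b. a \<in> K \<Longrightarrow> b \<in> K \<Longrightarrow> a \<le> b \<Longrightarrow> measure P {a..b} \<le> c"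
  shows "measure P K \<le> c"
proof -
  interpret finite_measure P by fact
  have "emeasure P K = (SUP C \<in> {C. C \<subseteq> K \<and> compact C}. emeasure P C)"
    using assms by (intro inner_regular) (auto simp: emeasure_eq_measure)
  also have "\<dots> \<le> ennreal c"
  proof (rule SUP_least)
    fix C assume "C \<in> {C. C \<subseteq> K \<and> compact C}"
    then have C: "C \<subseteq> K" "compact C" by auto
    show "emeasure P C \<le> ennreal c"
    proof (cases "C = {}")
      case False
      obtain a where a: "a \<in> C" "\<And>x. x \<in> C \<Longrightarrow> a \<le> x" using compact_attains_inf[OF C(2) False] by auto
      obtain b where b: "b \<in> C" "\<And>x. x \<in> C \<Longrightarrow> x \<le> b" using compact_attains_sup[OF C(2) False] by auto
      have "measure P C \<le> measure P {a..b}" using a b assms by (intro finite_measure_mono) auto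
      also have "\<dots> \<le> c" using a b C by (intro seg) auto
      finally show ?thesis by (simp add: emeasure_eq_measure ennreal_leI)
    qed simp
  qed
  finally show ?thesis using \<open>0 \<le> c\<close> by (simp add: emeasure_eq_measure)
qed

text \<open>The cell index of \<open>x\<close> is the integer part of \<open>m\<close> times the
  distribution function. Two points of one cell have distribution values at most
  \<open>1 / m\<close> apart, and absence of atoms turns this into a bound on the mass.\<close>

lemma quantile_grid:
  assumes s: "s \<in> densities" and m: "0 < m"
  obtains \<phi> :: "real \<Rightarrow> nat" where "mono \<phi>" "\<phi> \<in> measurable borel (count_space UNIV)" "\<And>x. \<phi> x \<le> m"
    "\<And>j. measure (law s) (\<phi> -` {j}) \<le> 1 / real m"
proof -
  interpret prob_space "law s" by (rule prob_space_law) fact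
  define F where "F x = measure (law s) {..x}" for x
  define \<phi> where "\<phi> x = nat \<lfloor>real m * F x\<rfloor>" for x
  have Fm: "mono F" unfolding F_def by (intro monoI finite_measure_mono) auto
  have F01: "0 \<le> F x" "F x \<le> 1" for x by (auto simp: F_def)
  have mono: "mono \<phi>" unfolding \<phi>_def
    by (intro monoI nat_mono floor_mono mult_left_mono monoD[OF Fm]) auto
  have [measurable]: "F \<in> borel_measurable borel" using Fm by (rule borel_measurable_mono)
  have meas[measurable]: "\<phi> \<in> measurable borel (count_space UNIV)" unfolding \<phi>_def by measurable
  show ?thesis
  proof (rule that[OF mono meas])
    fix x
    have "real m * F x \<le> real m * 1" by (intro mult_left_mono F01) auto
    then show "\<phi> x \<le> m" unfolding \<phi>_def by linarith
  next
    fix j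
    have \<phi>: "real (\<phi> x) \<le> real m * F x \<and> real m * F x < real (\<phi> x) + 1" for x
    proof -
      have "0 \<le> real m * F x" using F01 by simp
      then show ?thesis unfolding \<phi>_def by linarith
    qed
    show "measure (law s) (\<phi> -` {j}) \<le> 1 / real m"
    proof (rule measure_le_of_segments)
      show "finite_measure (law s)" by (rule finite_measure_axioms)
      show "\<phi> -` {j} \<in> sets borel" using measurable_sets[OF meas, of "{j}"] by simp
      fix a b assume "a \<in> \<phi> -` {j}" "b \<in> \<phi> -` {j}" and ab: "a \<le> b"
      then have "real m * F b - real m * F a \<le> 1" using \<phi>[of a] \<phi>[of b] by auto
      then have "F b - F a \<le> 1 / real m" using m by (simp add: field_simps)
      then show "measure (law s) {a..b} \<le> 1 / real m"
        unfolding measure_law_atLeastAtMost[OF s ab] F_def .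
    qed auto
  qed
qed

text \<open>A union of \<open>k\<close> cells of consecutive indices is encoded by its at most \<open>2 k\<close> switching points.\<close>

definition parity_set :: "(real \<Rightarrow> nat) \<Rightarrow> nat set \<Rightarrow> real set" where
  "parity_set \<phi> Q = {x. odd (card {q \<in> Q. q \<le> \<phi> x})}"

text \<open>The indices at which membership in \<open>B\<close> changes when read upwards,
  everything before 0 counting as outside. The conjunct \<open>0 < q\<close> guards the truncated
  subtraction \<open>q - 1\<close>.\<close>

definition switches :: "nat set \<Rightarrow> nat set" where
  "switches B = {q. (q \<in> B) \<noteq> (0 < q \<and> q - 1 \<in> B)}"

text \<open>Passing a switching index toggles both the parity of the count and membership in
  \<open>B\<close>.\<close>

lemma odd_card_switches: "odd (card {q \<in> switches B. q \<le> j}) \<longleftrightarrow> j \<in> B"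
proof (induction j)
  case 0
  have "{q \<in> switches B. q \<le> 0} = (if 0 \<in> B then {0} else {})" by (auto simp: switches_def)
  then show ?case by simp
next
  case (Suc j)
  have fin: "finite {q \<in> switches B. q \<le> j}" by simp
  have "{q \<in> switches B. q \<le> Suc j} = (if Suc j \<in> switches B then insert (Suc j) {q \<in> switches B. q \<le> j}
    else {q \<in> switches B. q \<le> j})" by (auto simp: le_Suc_eq)
  then show ?case using Suc fin by (auto simp: switches_def)
qed

lemma parity_set_switches: "parity_set \<phi> (switches B) = \<phi> -` B"
  by (auto simp: parity_set_def odd_card_switches)

lemma switches_UN_subset: "switches (\<Union>J\<in>C. f J) \<subseteq> (\<Union>J\<in>C. switches (f J))"
  by (auto simp: switches_def)

lemma switches_interval:
  "switches {a..b} \<subseteq> {a, Suc b}" "switches {a<..<b} \<subseteq> {Suc a, b}"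
  by (auto simp: switches_def)

text \<open>Take for \<open>a\<close> and \<open>b\<close> the extreme cell indices met by
  \<open>J\<close>. Since \<open>\<phi>\<close> is monotone, a point of a strictly intermediate cell
  lies between two points of \<open>J\<close>; only the two end cells can be met partially.\<close>

lemma interval_sandwich:
  fixes \<phi> :: "real \<Rightarrow> nat"
  assumes "mono \<phi>" "\<And>x. \<phi> x \<le> m" "is_interval J"
  shows "\<exists>a b. a \<le> m \<and> b \<le> m \<and> J \<subseteq> \<phi> -` {a..b} \<and> \<phi> -` {a<..<b} \<subseteq> J"
proof (cases "J = {}")
  case True
  then have "0 \<le> m \<and> 0 \<le> m \<and> J \<subseteq> \<phi> -` {0..0} \<and> \<phi> -` {0<..<0} \<subseteq> J" by simp
  then show ?thesis by blast
next
  case False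
  have fin: "finite (\<phi> ` J)" using assms(2) by (rule_tac finite_subset[of _ "{..m}"]) auto
  define a b where "a = Min (\<phi> ` J)" and "b = Max (\<phi> ` J)"
  have ab: "a \<in> \<phi> ` J" "b \<in> \<phi> ` J" using fin False by (auto simp: a_def b_def)
  then obtain x y where xy: "x \<in> J" "\<phi> x = a" "y \<in> J" "\<phi> y = b" by auto
  have "z \<in> J" if "a < \<phi> z" "\<phi> z < b" for z
  proof -
    have "\<not> z \<le> x" using monoD[OF assms(1), of z x] xy that by auto
    moreover have "\<not> y \<le> z" using monoD[OF assms(1), of y z] xy that by auto
    ultimately have "x \<le> z" "z \<le> y" by auto
    then show ?thesis using assms(3) xy unfolding is_interval_1 by blast
  qed
  moreover have "J \<subseteq> \<phi> -` {a..b}" using fin by (auto simp: a_def b_def)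
  moreover have "a \<le> m" "b \<le> m" using ab assms(2) by auto
  ultimately have "a \<le> m \<and> b \<le> m \<and> J \<subseteq> \<phi> -` {a..b} \<and> \<phi> -` {a<..<b} \<subseteq> J" by auto
  then show ?thesis by blast
qed

definition interval_union :: "nat \<Rightarrow> real set \<Rightarrow> bool" where
  "interval_union k A \<longleftrightarrow> (\<exists>C. finite C \<and> card C \<le> k \<and> (\<forall>J\<in>C. is_interval J) \<and> A = \<Union>C)"

text \<open>The codes of unions of cells with bounded complexity. The range extends to
  \<open>m + 1\<close> because a block that ends with cell \<open>m\<close> switches off one index
  later.\<close>

definition switch_sets :: "nat \<Rightarrow> nat \<Rightarrow> nat set set" where
  "switch_sets m d = {Q. Q \<subseteq> {..m + 1} \<and> card Q \<le> d}"

lemma finite_switch_sets [simp]: "finite (switch_sets m d)"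
  unfolding switch_sets_def by (rule finite_subset[of _ "Pow {..m+1}"]) auto

lemma parity_set_measurable:
  assumes "\<phi> \<in> measurable borel (count_space UNIV)"
  shows "parity_set \<phi> Q \<in> sets borel"
proof -
  have "parity_set \<phi> Q = \<phi> -` {j. odd (card {q \<in> Q. q \<le> j})}" by (auto simp: parity_set_def)
  then show ?thesis using measurable_sets[OF assms, of "{j. odd (card {q \<in> Q. q \<le> j})}"] by simp
qed

text \<open>The inner set omits and the outer set includes the end cells of every interval. They
  differ by at most \<open>2 * k\<close> cells of mass at most \<open>\<delta>\<close>, and each
  interval contributes at most two switches to either code.\<close>

lemma interval_union_sandwich:
  assumes \<phi>: "mono \<phi>" "\<phi> \<in> measurable borel (count_space UNIV)" "\<And>x. \<phi> x \<le> m"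
    and P: "prob_space P" "sets P = sets borel" "\<And>j. measure P (\<phi> -` {j}) \<le> \<delta>"
    and A: "interval_union k A"
  shows "\<exists>Q1\<in>switch_sets m (2 * k). \<exists>Q2\<in>switch_sets m (2 * k).
    parity_set \<phi> Q1 \<subseteq> A \<and> A \<subseteq> parity_set \<phi> Q2 \<and>
    measure P (parity_set \<phi> Q2) \<le> measure P (parity_set \<phi> Q1) + 2 * real k * \<delta>"
proof -
  interpret prob_space P by fact
  obtain C where C: "finite C" "card C \<le> k" "\<And>J. J \<in> C \<Longrightarrow> is_interval J" "A = \<Union>C"
    using A by (auto simp: interval_union_def)
  have "\<forall>J\<in>C. \<exists>a b. a \<le> m \<and> b \<le> m \<and> J \<subseteq> \<phi> -` {a..b} \<and> \<phi> -` {a<..<b} \<subseteq> J"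
    using interval_sandwich[OF \<phi>(1,3)] C(3) by blast
  then obtain a b where ab: "\<And>J. J \<in> C \<Longrightarrow> a J \<le> m \<and> b J \<le> m \<and> J \<subseteq> \<phi> -` {a J..b J} \<and> \<phi> -` {a J<..<b J} \<subseteq> J"
    by metis
  define B1 B2 where "B1 = (\<Union>J\<in>C. {a J<..<b J})" and "B2 = (\<Union>J\<in>C. {a J..b J})"
  have card2: "card (\<Union>J\<in>C. {f J, g J}) \<le> 2 * k" for f g :: "real set \<Rightarrow> nat"
  proof -
    have "card (\<Union>J\<in>C. {f J, g J}) \<le> (\<Sum>J\<in>C. card {f J, g J})" using C(1) by (rule card_UN_le)
    also have "\<dots> \<le> (\<Sum>J\<in>C. 2)" by (intro sum_mono) (simp add: card_insert_if)
    finally show ?thesis using C(2) by simp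
  qed
  have sub1: "switches B1 \<subseteq> (\<Union>J\<in>C. {Suc (a J), b J})"
    unfolding B1_def using switches_UN_subset[of "\<lambda>J. {a J<..<b J}" C] switches_interval(2) by blast
  have sub2: "switches B2 \<subseteq> (\<Union>J\<in>C. {a J, Suc (b J)})"
    unfolding B2_def using switches_UN_subset[of "\<lambda>J. {a J..b J}" C] switches_interval(1) by blast
  have "switches B1 \<subseteq> {..m+1}" using sub1 ab by fastforce
  moreover have "card (switches B1) \<le> 2 * k"
    by (rule order_trans[OF card_mono[OF _ sub1] card2]) (use C(1) in auto)
  ultimately have Q1: "switches B1 \<in> switch_sets m (2 * k)" by (simp add: switch_sets_def)
  have "switches B2 \<subseteq> {..m+1}" using sub2 ab by fastforce
  moreover have "card (switches B2) \<le> 2 * k"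
    by (rule order_trans[OF card_mono[OF _ sub2] card2]) (use C(1) in auto)
  ultimately have Q2: "switches B2 \<in> switch_sets m (2 * k)" by (simp add: switch_sets_def)
  have vm: "\<phi> -` B \<in> sets P" for B using measurable_sets[OF \<phi>(2), of B] P(2) by simp
  \<comment> \<open>The end cells: they cover whatever the outer set has in excess of the inner
    one.\<close>
  define R where "R = (\<Union>J\<in>C. {a J, b J})"
  have "\<phi> -` B2 \<subseteq> \<phi> -` B1 \<union> \<phi> -` R"
  proof
    fix x assume "x \<in> \<phi> -` B2"
    then obtain J where J: "J \<in> C" "a J \<le> \<phi> x" "\<phi> x \<le> b J" by (auto simp: B2_def)
    then have "\<phi> x \<in> {a J<..<b J} \<or> \<phi> x \<in> {a J, b J}" by auto
    then show "x \<in> \<phi> -` B1 \<union> \<phi> -` R" using J(1) unfolding B1_def R_def by blast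
  qed
  then have "measure P (\<phi> -` B2) \<le> measure P (\<phi> -` B1 \<union> \<phi> -` R)" using vm by (intro finite_measure_mono) auto
  also have "\<dots> \<le> measure P (\<phi> -` B1) + measure P (\<phi> -` R)" by (intro measure_Un_le vm)
  also have "measure P (\<phi> -` R) \<le> 2 * real k * \<delta>"
  proof -
    have "\<phi> -` R = (\<Union>j\<in>R. \<phi> -` {j})" by auto
    moreover have "measure P (\<Union>j\<in>R. \<phi> -` {j}) \<le> (\<Sum>j\<in>R. measure P (\<phi> -` {j}))"
      using C(1) by (intro finite_measure_subadditive_finite) (auto intro: vm simp: R_def)
    ultimately have "measure P (\<phi> -` R) \<le> (\<Sum>j\<in>R. measure P (\<phi> -` {j}))" by simp
    also have "\<dots> \<le> (\<Sum>j\<in>R. \<delta>)" by (intro sum_mono P)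
    also have "\<dots> = real (card R) * \<delta>" by simp
    also have "\<dots> \<le> real (2 * k) * \<delta>"
      using card2[of a b] order_trans[OF measure_nonneg P(3)[of 0]] unfolding R_def
      by (intro mult_right_mono) auto
    finally show ?thesis by simp
  qed
  finally have "measure P (parity_set \<phi> (switches B2)) \<le> measure P (parity_set \<phi> (switches B1)) + 2 * real k * \<delta>"
    by (simp add: parity_set_switches)
  moreover have "parity_set \<phi> (switches B1) \<subseteq> A" unfolding parity_set_switches B1_def C(4) using ab by blast
  moreover have "A \<subseteq> parity_set \<phi> (switches B2)" unfolding parity_set_switches B2_def C(4) using ab by blast
  ultimately show ?thesis using Q1 Q2 by blast
qed

section \<open>Size of the coded family and exponential moments of counts\<close>

text \<open>Weight each subset \<open>Q\<close> by \<open>x ^ card Q\<close>: every code has weight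
  at least \<open>x ^ d\<close>, and by the binomial expansion all subsets of
  \<open>{..m + 1}\<close> together weigh \<open>(1 + x) ^ (m + 2)\<close>.\<close>

lemma card_switch_sets_le:
  fixes x :: real
  assumes "0 < x" "x \<le> 1"
  shows "real (card (switch_sets m d)) * x ^ d \<le> exp (x * real (m + 2))"
proof -
  have "real (card (switch_sets m d)) * x ^ d = (\<Sum>Q\<in>switch_sets m d. x ^ d)" by simp
  also have "\<dots> \<le> (\<Sum>Q\<in>switch_sets m d. x ^ card Q)"
    using assms by (intro sum_mono power_decreasing) (auto simp: switch_sets_def)
  also have "\<dots> \<le> (\<Sum>Q\<in>Pow {..m + 1}. x ^ card Q)"
    using assms by (intro sum_mono2) (auto simp: switch_sets_def)
  also have "\<dots> = (x + 1) ^ (m + 2)"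
    using prod_add[of "{..m+1}" "\<lambda>_. x" "\<lambda>_. 1"] by simp
  also have "\<dots> \<le> exp x ^ (m + 2)"
    using assms exp_ge_add_one_self[of x] by (intro power_mono) (auto simp: add.commute)
  also have "\<dots> = exp (x * real (m + 2))" by (simp only: exp_of_nat_mult[symmetric] mult.commute)
  finally show ?thesis .
qed

lemma exp_quadratic_bound:
  fixes x :: real assumes "\<bar>x\<bar> \<le> 1" shows "exp x \<le> 1 + x + x\<^sup>2"
proof (cases "0 \<le> x")
  case True
  then show ?thesis using exp_bound[of x] assms by simp
next
  case False
  define y where "y = - x"
  have y: "0 < y" "y \<le> 1" using False assms by (auto simp: y_def)
  have "exp x = 1 / exp y" by (simp add: y_def exp_minus field_simps)
  also have "\<dots> \<le> 1 / (1 + y)" using y exp_ge_add_one_self[of y] by (intro divide_left_mono) auto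
  also have "\<dots> \<le> 1 - y + y\<^sup>2"
  proof -
    have "(1 - y + y\<^sup>2) * (1 + y) = 1 + y ^ 3" by (simp add: power2_eq_square power3_eq_cube algebra_simps)
    then have "1 \<le> (1 - y + y\<^sup>2) * (1 + y)" using y by simp
    then show ?thesis using y by (simp add: divide_le_eq)
  qed
  finally show ?thesis by (simp add: y_def)
qed

definition hits :: "nat \<Rightarrow> real set \<Rightarrow> (nat \<Rightarrow> real) \<Rightarrow> real" where
  "hits n A X = (\<Sum>i\<in>{1..n}. indicator A (X i))"

text \<open>Bernstein-type bound: independence factorizes the moment, each factor is at most
  \<open>exp ((l + l\<^sup>2) * p)\<close>, and the compensator
  \<open>l\<^sup>2 * (real n * p)\<close> makes the bound 1. Both signs of \<open>l\<close> are
  allowed, for upper and lower deviations.\<close>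

lemma exponential_moment_hits:
  assumes s: "s \<in> densities" and A: "A \<in> sets borel" and l: "\<bar>l\<bar> \<le> 1"
  defines "p \<equiv> measure (law s) A"
  shows "integrable (iid_sample n s) (\<lambda>X. exp (l * (hits n A X - real n * p) - l\<^sup>2 * (real n * p)))"
    "(\<integral>X. exp (l * (hits n A X - real n * p) - l\<^sup>2 * (real n * p)) \<partial>iid_sample n s) \<le> 1"
proof -
  interpret L: prob_space "law s" by (rule prob_space_law) fact
  interpret product_prob_space "\<lambda>_. law s" "{1..n}" by unfold_locales
  have iid: "iid_sample n s = PiM {1..n} (\<lambda>_. law s)" by (simp add: iid_sample_def law_def)
  define f where "f x = exp (l * indicator A x)" for x :: real
  have f: "f x = 1 + (exp l - 1) * indicator A x" for x by (simp add: f_def indicator_def)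
  have intA: "integrable (law s) (indicator A :: real \<Rightarrow> real)"
    using A by (intro L.integrable_const_bound[of _ 1]) (auto simp: indicator_def)
  have intf: "integrable (law s) f" unfolding f using intA by simp
  have Ef: "(\<integral>x. f x \<partial>law s) = 1 + (exp l - 1) * p"
    unfolding f using intA A by (simp add: p_def L.prob_space[simplified])
  have p0: "0 \<le> p" by (simp add: p_def)
  have eq: "exp (l * (hits n A X - real n * p) - l\<^sup>2 * (real n * p))
     = exp (- ((l + l\<^sup>2) * (real n * p))) * (\<Prod>i\<in>{1..n}. f (X i))" for X
  proof -
    have "(\<Prod>i\<in>{1..n}. f (X i)) = exp (l * hits n A X)"
      unfolding f_def hits_def sum_distrib_left by (subst exp_sum) simp_all
    then show ?thesis by (simp add: exp_add[symmetric] algebra_simps)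
  qed
  have int: "integrable (iid_sample n s) (\<lambda>X. \<Prod>i\<in>{1..n}. f (X i))"
    unfolding iid by (rule product_integrable_prod) (auto intro: intf)
  then show "integrable (iid_sample n s) (\<lambda>X. exp (l * (hits n A X - real n * p) - l\<^sup>2 * (real n * p)))"
    unfolding eq by simp
  have "(\<integral>X. (\<Prod>i\<in>{1..n}. f (X i)) \<partial>iid_sample n s) = (\<Prod>i\<in>{1..n}. integral\<^sup>L (law s) f)"
    unfolding iid by (rule product_integral_prod) (auto intro: intf)
  also have "\<dots> = (1 + (exp l - 1) * p) ^ n" by (simp add: Ef)
  also have "\<dots> \<le> exp ((l + l\<^sup>2) * p) ^ n"
  proof (rule power_mono)
    have "(exp l - 1) * p \<le> (l + l\<^sup>2) * p" using exp_quadratic_bound[OF l] p0 by (intro mult_right_mono) auto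
    then show "1 + (exp l - 1) * p \<le> exp ((l + l\<^sup>2) * p)" using exp_ge_add_one_self[of "(l + l\<^sup>2) * p"] by linarith
    have "0 \<le> (\<integral>x. f x \<partial>law s)" by (intro integral_nonneg_AE) (simp add: f_def)
    then show "0 \<le> 1 + (exp l - 1) * p" by (simp add: Ef)
  qed
  also have "\<dots> = exp ((l + l\<^sup>2) * (real n * p))" by (simp add: exp_of_nat_mult[symmetric] ac_simps)
  finally have "(\<integral>X. (\<Prod>i\<in>{1..n}. f (X i)) \<partial>iid_sample n s) \<le> exp ((l + l\<^sup>2) * (real n * p))" .
  then have "exp (- ((l + l\<^sup>2) * (real n * p))) * (\<integral>X. (\<Prod>i\<in>{1..n}. f (X i)) \<partial>iid_sample n s)
     \<le> exp (- ((l + l\<^sup>2) * (real n * p))) * exp ((l + l\<^sup>2) * (real n * p))"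
    by (intro mult_left_mono) auto
  then show "(\<integral>X. exp (l * (hits n A X - real n * p) - l\<^sup>2 * (real n * p)) \<partial>iid_sample n s) \<le> 1"
    unfolding eq by (simp add: exp_add[symmetric] del: exp_add)
qed

section \<open>Level sets of ratios of log-concave densities\<close>

text \<open>The two parts are the points of \<open>J\<close> to the left and to the right of all of
  \<open>C\<close>; any other point lies between two points of \<open>C\<close> and hence in
  it.\<close>

lemma interval_Diff:
  fixes J C :: "real set"
  assumes "is_interval J" "is_interval C"
  shows "\<exists>L R. is_interval L \<and> is_interval R \<and> J - C = L \<union> R"
proof (intro exI conjI)
  let ?L = "{x \<in> J. \<forall>y\<in>C. x < y}" and ?R = "{x \<in> J. \<forall>y\<in>C. y < x}"
  have J: "z \<in> J" if "x \<in> J" "y \<in> J" "x \<le> z" "z \<le> y" for x y z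
    using assms(1) that unfolding is_interval_1 by blast
  show "is_interval ?L" unfolding is_interval_1
  proof (intro ballI allI impI, elim conjE)
    fix x y z assume "x \<in> ?L" "y \<in> ?L" "x \<le> z" "z \<le> y"
    then show "z \<in> ?L" using J[of x y z] by force
  qed
  show "is_interval ?R" unfolding is_interval_1
  proof (intro ballI allI impI, elim conjE)
    fix x y z assume "x \<in> ?R" "y \<in> ?R" "x \<le> z" "z \<le> y"
    then show "z \<in> ?R" using J[of x y z] by force
  qed
  show "J - C = ?L \<union> ?R"
  proof (intro equalityI subsetI)
    fix x assume x: "x \<in> J - C"
    have "(\<forall>y\<in>C. x < y) \<or> (\<forall>y\<in>C. y < x)"
    proof (rule ccontr)
      assume "\<not> ?thesis"
      then obtain y z where "y \<in> C" "y \<le> x" "z \<in> C" "x \<le> z" by (meson not_le)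
      then show False using assms(2) x unfolding is_interval_1 by blast
    qed
    then show "x \<in> ?L \<union> ?R" using x by auto
  qed auto
qed

text \<open>These are sublevel sets of the convex function \<open>a * x + b - g x\<close>.\<close>

lemma concave_above_affine_interval:
  fixes g :: "real \<Rightarrow> real"
  assumes "concave_on I g" "is_interval J"
  shows "is_interval {x \<in> J \<inter> I. a * x + b < g x}" "is_interval {x \<in> J \<inter> I. a * x + b \<le> g x}"
proof -
  define h where "h x = a * x + b - g x" for x
  have I: "is_interval I" using assms(1) unfolding is_interval_convex_1 concave_on_def
    by (rule convex_on_imp_convex)
  have "convex_on I (\<lambda>x. a * x + b)"
    using I unfolding is_interval_convex_1 convex_on_def
    by (simp add: algebra_simps) (metis distrib_left mult.commute mult.right_neutral order_refl)
  then have h: "convex_on I h" unfolding h_def using assms(1) by (rule convex_on_diff)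
  have key: "z \<in> J \<inter> I \<and> h z \<le> max (h x) (h y)"
    if "x \<in> J \<inter> I" "y \<in> J \<inter> I" "x \<le> z" "z \<le> y" for x y z
  proof (intro conjI)
    show "z \<in> J \<inter> I" using assms(2) I that unfolding is_interval_1 by blast
    have "{x..y} \<subseteq> I" using I that unfolding is_interval_1 by (auto simp: subset_iff)
    then have "convex_on {x..y} h" by (rule convex_on_subset[OF h]) simp
    then show "h z \<le> max (h x) (h y)" using that by (intro convex_on_le_max) auto
  qed
  have "is_interval {x \<in> J \<inter> I. h x < 0}" unfolding is_interval_1
  proof (intro ballI allI impI, elim conjE)
    fix x y z assume "x \<in> {x \<in> J \<inter> I. h x < 0}" "y \<in> {x \<in> J \<inter> I. h x < 0}" "x \<le> z" "z \<le> y"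
    then show "z \<in> {x \<in> J \<inter> I. h x < 0}" using key[of x y z] by (auto simp: max_def split: if_splits)
  qed
  then show "is_interval {x \<in> J \<inter> I. a * x + b < g x}" by (simp add: h_def)
  have "is_interval {x \<in> J \<inter> I. h x \<le> 0}" unfolding is_interval_1
  proof (intro ballI allI impI, elim conjE)
    fix x y z assume "x \<in> {x \<in> J \<inter> I. h x \<le> 0}" "y \<in> {x \<in> J \<inter> I. h x \<le> 0}" "x \<le> z" "z \<le> y"
    then show "z \<in> {x \<in> J \<inter> I. h x \<le> 0}" using key[of x y z] by (auto simp: max_def split: if_splits)
  qed
  then show "is_interval {x \<in> J \<inter> I. a * x + b \<le> g x}" by (simp add: h_def)
qed

text \<open>On a piece of \<open>t\<close> the inequality compares the concave \<open>ln u\<close>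
  with the affine \<open>ln t + ln \<kappa>\<close>. The first set has one interval per piece and at
  most two more outside the support of \<open>t\<close>; the second is a complement inside each
  piece, so at most two intervals per piece. The number \<open>2 * D + 2\<close> serves
  both.\<close>

lemma level_sets_interval_union:
  assumes u: "u \<in> log_concave_densities" and t: "t \<in> log_affine_densities D" and k: "0 < \<kappa>"
  shows "interval_union (2 * D + 2) {x. \<kappa> * t x < u x}" "interval_union (2 * D + 2) {x. u x < \<kappa> * t x}"
proof -
  obtain I g where I: "is_interval I" "piecewise_affine_on I D g" "t = (\<lambda>x. indicator I x * exp (g x))"
    using t by (auto simp: log_affine_densities_def)
  obtain I' g' where I': "is_interval I'" "concave_on I' g'" "u = (\<lambda>x. indicator I' x * exp (g' x))"
    using u by (auto simp: log_concave_densities_def)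
  obtain P where P: "partition_on I P" "finite P" "card P = D"
    "\<And>J. J \<in> P \<Longrightarrow> is_interval J \<and> (\<exists>a b. \<forall>x\<in>J. g x = a * x + b)"
    using I(2) by (auto simp: piecewise_affine_on_def)
  have UP: "\<Union>P = I" using P(1) by (simp add: partition_on_def)
  have piece: "is_interval {x \<in> J. \<kappa> * t x < u x} \<and> is_interval {x \<in> J. \<kappa> * t x \<le> u x}" if J: "J \<in> P" for J
  proof -
    obtain a b where ab: "\<And>x. x \<in> J \<Longrightarrow> g x = a * x + b" and int: "is_interval J" using P(4)[OF J] by blast
    have kt: "\<kappa> * t x = exp (a * x + (b + ln \<kappa>))" if "x \<in> J" for x
      using that J UP ab k by (auto simp: I(3) exp_add indicator_def)
    have "{x \<in> J. \<kappa> * t x < u x} = {x \<in> J \<inter> I'. a * x + (b + ln \<kappa>) < g' x}"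
      using kt by (auto simp: I'(3) indicator_def split: if_splits)
    moreover have "{x \<in> J. \<kappa> * t x \<le> u x} = {x \<in> J \<inter> I'. a * x + (b + ln \<kappa>) \<le> g' x}"
      using kt by (auto simp: I'(3) indicator_def split: if_splits)
    ultimately show ?thesis using concave_above_affine_interval[OF I'(2) int] by simp
  qed
  show "interval_union (2 * D + 2) {x. \<kappa> * t x < u x}"
  proof -
    \<comment> \<open>Off \<open>I\<close> the density \<open>t\<close> is 0, so the inequality
      holds exactly where \<open>u\<close> is positive.\<close>
    obtain L R where LR: "is_interval L" "is_interval R" "I' - I = L \<union> R" using interval_Diff[OF I'(1) I(1)] by blast
    define C where "C = (\<lambda>J. {x \<in> J. \<kappa> * t x < u x}) ` P \<union> {L, R}"
    have "finite C" using P by (simp add: C_def)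
    moreover have "card C \<le> 2 * D + 2"
    proof -
      have "card C \<le> card ((\<lambda>J. {x \<in> J. \<kappa> * t x < u x}) ` P) + card {L, R}" unfolding C_def by (rule card_Un_le)
      also have "\<dots> \<le> D + 2" using card_image_le[OF P(2)] P(3) by (intro add_mono) (auto simp: card_insert_if)
      finally show ?thesis by simp
    qed
    moreover have "\<forall>J\<in>C. is_interval J" using piece LR by (auto simp: C_def)
    moreover have "{x. \<kappa> * t x < u x} = \<Union>C"
    proof -
      have "{x. \<kappa> * t x < u x} = {x \<in> I. \<kappa> * t x < u x} \<union> (I' - I)"
        by (auto simp: I(3) I'(3) indicator_def split: if_splits)
      also have "{x \<in> I. \<kappa> * t x < u x} = (\<Union>J\<in>P. {x \<in> J. \<kappa> * t x < u x})" using UP by auto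
      finally show ?thesis unfolding C_def LR(3) by blast
    qed
    ultimately show ?thesis unfolding interval_union_def by blast
  qed
  show "interval_union (2 * D + 2) {x. u x < \<kappa> * t x}"
  proof -
    \<comment> \<open>The complement of the strict inequality is the non-strict one, which
      \<open>piece\<close> also shows to cut out an interval.\<close>
    have "\<forall>J\<in>P. \<exists>L R. is_interval L \<and> is_interval R \<and> J - {x \<in> J. \<kappa> * t x \<le> u x} = L \<union> R"
      using interval_Diff piece P(4) by blast
    then obtain L R where LR: "\<And>J. J \<in> P \<Longrightarrow> is_interval (L J) \<and> is_interval (R J) \<and> J - {x \<in> J. \<kappa> * t x \<le> u x} = L J \<union> R J"
      by metis
    define C where "C = L ` P \<union> R ` P"
    have "finite C" using P by (simp add: C_def)
    moreover have "card C \<le> 2 * D + 2"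
    proof -
      have "card C \<le> card (L ` P) + card (R ` P)" unfolding C_def by (rule card_Un_le)
      also have "\<dots> \<le> D + D" using card_image_le[OF P(2)] P(3) by (intro add_mono) auto
      finally show ?thesis by simp
    qed
    moreover have "\<forall>J\<in>C. is_interval J" using LR by (auto simp: C_def)
    moreover have "{x. u x < \<kappa> * t x} = \<Union>C"
    proof -
      have "{x. u x < \<kappa> * t x} = {x \<in> I. u x < \<kappa> * t x}"
        by (auto simp: I(3) I'(3) indicator_def split: if_splits)
      also have "\<dots> = (\<Union>J\<in>P. J - {x \<in> J. \<kappa> * t x \<le> u x})" using UP by auto
      also have "\<dots> = (\<Union>J\<in>P. L J \<union> R J)" using LR by simp
      also have "\<dots> = \<Union>C" by (auto simp: C_def)
      finally show ?thesis .
    qed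
    ultimately show ?thesis unfolding interval_union_def by blast
  qed
qed

lemma log_concave_subset_densities: "log_concave_densities \<subseteq> densities"
  by (auto simp: log_concave_densities_def)

lemma log_affine_subset_log_concave: "log_affine_densities D \<subseteq> log_concave_densities"
  by (auto simp: log_concave_densities_def log_affine_densities_def)

text \<open>The negative side follows by exchanging the arguments of psi, which replaces the
  threshold by its inverse. The value \<open>c = 1\<close>, the height of the top layer later on,
  lies outside the threshold lemma; both sets are empty there.\<close>

lemma psi_ratio_level_sets_interval_union:
  assumes u: "u \<in> log_concave_densities" and t: "t \<in> log_affine_densities D" and c: "0 < c" "c \<le> 1"
  shows "interval_union (2 * D + 2) {x. c < psi_ratio (u x) (t x)}" "interval_union (2 * D + 2) {x. psi_ratio (u x) (t x) < - c}"
proof -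
  have nn: "0 \<le> u x" "0 \<le> t x" for x
    using u t log_concave_subset_densities log_affine_subset_log_concave by (blast intro: densities_nonneg)+
  have "interval_union (2 * D + 2) {x. c < psi_ratio (u x) (t x)} \<and> interval_union (2 * D + 2) {x. psi_ratio (u x) (t x) < - c}"
  proof (cases "c = 1")
    case True
    have e: "interval_union (2 * D + 2) {}" unfolding interval_union_def by (intro exI[of _ "{}"]) auto
    have b: "- 1 \<le> psi_ratio (u x) (t x)" "psi_ratio (u x) (t x) \<le> 1" for x
      using abs_psi_ratio_le_1[of "u x" "t x"] nn by (simp_all add: abs_le_iff)
    have "{x. c < psi_ratio (u x) (t x)} = {}" "{x. psi_ratio (u x) (t x) < - c} = {}" using b True by (auto simp: not_less)
    then show ?thesis using e by simp
  next
    case False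
    then obtain \<kappa> where \<kappa>: "\<kappa> > 0" "\<And>a b. 0 \<le> a \<Longrightarrow> 0 \<le> b \<Longrightarrow> psi_ratio a b > c \<longleftrightarrow> a > \<kappa> * b"
      using psi_ratio_gt_iff_threshold[of c] c by auto
    have "{x. c < psi_ratio (u x) (t x)} = {x. \<kappa> * t x < u x}" using \<kappa>(2) nn by auto
    moreover have "{x. psi_ratio (u x) (t x) < - c} = {x. u x < 1 / \<kappa> * t x}"
    proof (intro Collect_cong)
      fix x
      have "psi_ratio (u x) (t x) < - c \<longleftrightarrow> c < psi_ratio (t x) (u x)" using psi_ratio_swap[of "t x" "u x"] by auto
      also have "\<dots> \<longleftrightarrow> \<kappa> * u x < t x" using \<kappa>(2) nn by auto
      also have "\<dots> \<longleftrightarrow> u x < 1 / \<kappa> * t x" using \<kappa>(1) by (simp add: field_simps)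
      finally show "psi_ratio (u x) (t x) < - c \<longleftrightarrow> u x < 1 / \<kappa> * t x" .
    qed
    ultimately show ?thesis using level_sets_interval_union[OF u t, of \<kappa>] level_sets_interval_union[OF u t, of "1 / \<kappa>"] \<kappa>(1)
      by simp
  qed
  then show "interval_union (2 * D + 2) {x. c < psi_ratio (u x) (t x)}" "interval_union (2 * D + 2) {x. psi_ratio (u x) (t x) < - c}"
    by auto
qed

text \<open>Needed for lower bounds on the real-valued inner infimum. The witness is the uniform
  density on the unit interval, with the constant exponent 0 cut into \<open>D\<close> equal
  slices.\<close>

lemma log_affine_densities_nonempty:
  assumes "1 \<le> D" shows "log_affine_densities D \<noteq> {}"
proof -
  define I :: "real set" where "I = {0<..<1}"
  define t :: "real \<Rightarrow> real" where "t = (\<lambda>x. indicator I x * exp 0)"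
  have "(\<integral>\<^sup>+x. ennreal (t x) \<partial>lborel) = emeasure lborel I"
    by (subst nn_integral_indicator[symmetric]) (auto simp: t_def I_def ennreal_indicator)
  then have "(\<integral>\<^sup>+x. ennreal (t x) \<partial>lborel) = 1" by (simp add: I_def)
  moreover have "t \<in> borel_measurable borel" by (simp add: t_def I_def)
  moreover have "\<forall>x. 0 \<le> t x" by (simp add: t_def)
  ultimately have t: "t \<in> densities" by (simp add: densities_def)
  define J where "J i = {x \<in> I. real i \<le> real D * x \<and> real D * x < real (Suc i)}" for i :: nat
  have uniq: "i = j" if "x \<in> J i" "x \<in> J j" for x i j
  proof -
    have "real i < real (Suc j)" "real j < real (Suc i)"
      using that unfolding J_def mem_Collect_eq by linarith+
    then have "i < Suc j" "j < Suc i" by (simp_all only: of_nat_less_iff)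
    then show ?thesis by simp
  qed
  \<comment> \<open>The midpoints show that the slices are nonempty and, with \<open>uniq\<close>,
    that there are exactly \<open>D\<close> of them.\<close>
  have mid: "(real i + 1/2) / real D \<in> J i" if "i < D" for i
  proof -
    define x where "x = (real i + 1/2) / real D"
    have Dx: "real D * x = real i + 1/2" using assms by (simp add: x_def)
    have "real i + 1 \<le> real D" using that by linarith
    then have "0 < x" "x < 1" using assms by (simp_all add: x_def divide_less_eq)
    then show ?thesis unfolding x_def[symmetric] by (simp add: J_def I_def Dx)
  qed
  have "inj_on J {..<D}"
  proof (rule inj_onI)
    fix i j assume ij: "i \<in> {..<D}" "j \<in> {..<D}" "J i = J j"
    then show "i = j" using uniq[of "(real i + 1/2) / real D" i j] mid[of i] by simp
  qed
  then have card: "card (J ` {..<D}) = D" by (simp add: card_image)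
  have part: "partition_on I (J ` {..<D})"
  proof (rule partition_onI)
    show "\<Union> (J ` {..<D}) = I"
    proof (intro equalityI subsetI)
      fix x assume x: "x \<in> I"
      define i where "i = nat \<lfloor>real D * x\<rfloor>"
      have "0 < x" "x < 1" using x by (auto simp: I_def)
      then have "0 < real D * x" "real D * x < real D * 1" using assms by (auto intro!: mult_strict_left_mono)
      then have "real i \<le> real D * x" "real D * x < real (Suc i)" "i < D" unfolding i_def by linarith+
      then show "x \<in> \<Union> (J ` {..<D})" using x by (auto simp: J_def)
    qed (auto simp: J_def)
    show "{} \<notin> J ` {..<D}" using mid by fastforce
  next
    fix p q assume pq: "p \<in> J ` {..<D}" "q \<in> J ` {..<D}" "p \<noteq> q"
    then obtain i j where "p = J i" "q = J j" by auto
    then show "disjnt p q" using uniq pq(3) unfolding disjnt_iff by blast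
  qed
  have "is_interval (J i)" for i
  proof -
    have "J i = I \<inter> {real i / real D..<real (Suc i) / real D}"
      using assms by (auto simp: J_def pos_divide_le_eq pos_less_divide_eq mult.commute)
    then show ?thesis by (simp add: I_def is_interval_convex_1 convex_Int)
  qed
  then have "piecewise_affine_on I D (\<lambda>_. 0)"
    unfolding piecewise_affine_on_def using part card
    by (intro exI[of _ "J ` {..<D}"]) (auto intro!: exI[of _ "0::real"])
  moreover have "concave_on I (\<lambda>_. 0)" by (simp add: I_def concave_on_const)
  ultimately have "t \<in> log_affine_densities D"
    unfolding log_affine_densities_def using t
    by (auto simp: t_def I_def is_interval_convex_1 intro!: exI[of _ "{0<..<1::real}"] exI[of _ "\<lambda>_. 0::real"])
  then show ?thesis by auto
qed

section \<open>Uniform deviations\<close>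

text \<open>Each compensated deviation is at most the logarithm of the sum of all exponentials.
  \<open>W\<close> is the tangent of this logarithm at \<open>K\<close>, the number of indices,
  which bounds the expectation of the sum; thus \<open>W\<close> dominates every index and has mean
  at most \<open>ln K\<close>.\<close>

lemma exponential_union_bound:
  assumes s: "s \<in> densities" and J: "finite J" "J \<noteq> {}"
    and A: "\<And>j. j \<in> J \<Longrightarrow> A j \<in> sets borel" and l: "\<And>j. j \<in> J \<Longrightarrow> \<bar>l j\<bar> \<le> 1"
  obtains W where "integrable (iid_sample n s) W" "(\<integral>X. W X \<partial>iid_sample n s) \<le> ln (real (card J))"
    "\<And>X j. j \<in> J \<Longrightarrow> l j * (hits n (A j) X - real n * measure (law s) (A j))
        \<le> (l j)\<^sup>2 * (real n * measure (law s) (A j)) + W X"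
proof -
  interpret L: prob_space "law s" by (rule prob_space_law) fact
  interpret I: prob_space "iid_sample n s" unfolding iid_sample_def law_def[symmetric]
    by (intro prob_space_PiM L.prob_space_axioms)
  define K where "K = real (card J)"
  have K: "K > 0" using J by (simp add: K_def card_gt_0_iff)
  define Y where "Y j X = l j * (hits n (A j) X - real n * measure (law s) (A j))
        - (l j)\<^sup>2 * (real n * measure (law s) (A j))" for j X
  define W where "W X = ln K - 1 + (\<Sum>j\<in>J. exp (Y j X)) / K" for X
  have int: "integrable (iid_sample n s) (\<lambda>X. exp (Y j X))" "(\<integral>X. exp (Y j X) \<partial>iid_sample n s) \<le> 1" if "j \<in> J" for j
    unfolding Y_def using exponential_moment_hits[OF s A[OF that] l[OF that]] by auto
  show ?thesis
  proof (rule that)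
    show "integrable (iid_sample n s) W" unfolding W_def using int by simp
    have "(\<integral>X. W X \<partial>iid_sample n s) = ln K - 1 + (\<Sum>j\<in>J. \<integral>X. exp (Y j X) \<partial>iid_sample n s) / K"
      unfolding W_def using int by (simp add: I.prob_space)
    also have "\<dots> \<le> ln K - 1 + (\<Sum>j\<in>J. 1) / K"
      using int K by (intro add_mono divide_right_mono sum_mono) auto
    also have "\<dots> = ln K" using K by (simp add: K_def)
    finally show "(\<integral>X. W X \<partial>iid_sample n s) \<le> ln (real (card J))" by (simp add: K_def)
    fix X j assume j: "j \<in> J"
    have "exp (Y j X) \<le> (\<Sum>j\<in>J. exp (Y j X))" using J j by (intro member_le_sum) auto
    moreover have "1 + (Y j X - ln K) \<le> exp (Y j X - ln K)" by (rule exp_ge_add_one_self)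
    moreover have "exp (Y j X - ln K) = exp (Y j X) / K" using K by (simp add: exp_diff)
    moreover have "exp (Y j X) / K \<le> (\<Sum>j\<in>J. exp (Y j X)) / K" using calculation K by (simp add: divide_right_mono)
    ultimately have "Y j X \<le> W X" unfolding W_def by linarith
    then show "l j * (hits n (A j) X - real n * measure (law s) (A j))
        \<le> (l j)\<^sup>2 * (real n * measure (law s) (A j)) + W X" by (simp add: Y_def)
  qed
qed

section \<open>Layer decomposition of bounded functions\<close>

text \<open>The layers below \<open>y\<close> number \<open>N\<close>, so their average
  \<open>c\<close> is \<open>y\<close> rounded down to the grid of step \<open>1 / M\<close>. An
  active layer has height below \<open>y\<close>, so the height-weighted average is at most
  \<open>y * c\<close>.\<close>

lemma layer_sum_nonneg:
  fixes y :: real and M :: nat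
  assumes M: "0 < M" and y: "0 \<le> y" "y \<le> 1"
  defines "c \<equiv> (\<Sum>i\<in>{1..M}. (if real i / real M < y then 1 else 0)) / real M"
  shows "c \<le> y" "y \<le> c + 1 / real M"
    "(\<Sum>i\<in>{1..M}. real i / real M * (if real i / real M < y then 1 else 0)) / real M \<le> y\<^sup>2"
proof -
  \<comment> \<open>Ceiling minus one counts the indices strictly below \<open>real M * y\<close>;
    at \<open>y = 0\<close> the truncated subtraction gives 0.\<close>
  define N where "N = nat \<lceil>real M * y\<rceil> - 1"
  have My: "0 \<le> real M * y" "real M * y \<le> real M * 1" using y by (simp, intro mult_left_mono) auto
  have N: "real N \<le> real M * y" "real M * y \<le> real N + 1" unfolding N_def using My by linarith+
  have "{i\<in>{1..M}. real i / real M < y} = {1..N}"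
  proof (intro equalityI subsetI)
    fix i assume "i \<in> {i\<in>{1..M}. real i / real M < y}"
    then have "1 \<le> i" "real i < real M * y" using M by (auto simp: field_simps)
    then show "i \<in> {1..N}" unfolding N_def by simp linarith
  next
    fix i assume "i \<in> {1..N}"
    then have "1 \<le> i" "real i < real M * y" unfolding N_def by simp_all linarith
    moreover from this have "i \<le> M" using My by linarith
    ultimately show "i \<in> {i\<in>{1..M}. real i / real M < y}" using M by (simp add: field_simps)
  qed
  then have c: "c = real N / real M" unfolding c_def by (simp add: sum.If_cases Int_def)
  show "c \<le> y" unfolding c using N M by (simp add: field_simps)
  show "y \<le> c + 1 / real M" unfolding c using N M by (simp add: field_simps)
  have "(\<Sum>i\<in>{1..M}. real i / real M * (if real i / real M < y then 1 else 0)) / real M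
     \<le> (\<Sum>i\<in>{1..M}. y * (if real i / real M < y then 1 else 0)) / real M"
    by (intro divide_right_mono sum_mono) (use y in auto)
  also have "\<dots> = y * c" by (simp add: c_def sum_distrib_left)
  also have "\<dots> \<le> y\<^sup>2" using \<open>c \<le> y\<close> y by (simp add: power2_eq_square mult_left_mono)
  finally show "(\<Sum>i\<in>{1..M}. real i / real M * (if real i / real M < y then 1 else 0)) / real M \<le> y\<^sup>2" .
qed

lemma layer_sum:
  fixes y :: real and M :: nat
  assumes M: "0 < M" and y: "\<bar>y\<bar> \<le> 1"
  shows "\<bar>y - (\<Sum>i\<in>{1..M}. indicator {real i / real M<..} y - indicator {..<- (real i / real M)} y) / real M\<bar> \<le> 1 / real M"
    "(\<Sum>i\<in>{1..M}. real i / real M * (indicator {real i / real M<..} y + indicator {..<- (real i / real M)} y)) / real M \<le> y\<^sup>2"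
proof -
  have "\<bar>y - (\<Sum>i\<in>{1..M}. indicator {real i / real M<..} y - indicator {..<- (real i / real M)} y) / real M\<bar> \<le> 1 / real M
    \<and> (\<Sum>i\<in>{1..M}. real i / real M * (indicator {real i / real M<..} y + indicator {..<- (real i / real M)} y)) / real M \<le> y\<^sup>2"
  proof (cases "0 \<le> y")
    case True
    have i: "indicator {..<- (real i / real M)} y = (0::real)" for i
    proof -
      have "0 \<le> real i / real M" by simp
      then have "y \<notin> {..<- (real i / real M)}" using True by (auto simp del: divide_nonneg_nonneg)
      then show ?thesis by simp
    qed
    have j: "indicator {real i / real M<..} y = (if real i / real M < y then 1 else (0::real))" for i
      by (simp add: indicator_def)
    show ?thesis unfolding i j using layer_sum_nonneg[OF M True] y by (auto simp: abs_le_iff)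
  next
    case False
    have i: "indicator {real i / real M<..} y = (0::real)" for i
    proof -
      have "0 \<le> real i / real M" by simp
      then have "y \<notin> {real i / real M<..}" using False by (auto simp del: divide_nonneg_nonneg)
      then show ?thesis by simp
    qed
    have j: "indicator {..<- (real i / real M)} y = (if real i / real M < - y then 1 else (0::real))" for i
      by (auto simp add: indicator_def)
    show ?thesis unfolding i j using layer_sum_nonneg[OF M, of "- y"] y False
      by (auto simp: abs_le_iff sum_negf)
  qed
  then show "\<bar>y - (\<Sum>i\<in>{1..M}. indicator {real i / real M<..} y - indicator {..<- (real i / real M)} y) / real M\<bar> \<le> 1 / real M"
    "(\<Sum>i\<in>{1..M}. real i / real M * (indicator {real i / real M<..} y + indicator {..<- (real i / real M)} y)) / real M \<le> y\<^sup>2"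
    by auto
qed

section \<open>Deviations of interval unions and of functions\<close>

lemma hits_mono: "A \<subseteq> B \<Longrightarrow> hits n A X \<le> hits n B X"
  unfolding hits_def by (intro sum_mono) (auto simp: indicator_def)

text \<open>Upper deviations are read off the outer set and lower ones off the inner set; dividing
  the exponential bounds by \<open>l\<close> gives the term \<open>w / l\<close>. The outer set
  exceeds the inner one by at most \<open>2 * k\<close> in expected count. This enters once in the
  centring and once in the variance term, where \<open>l \<le> 1\<close>; hence
  \<open>4 * k\<close>.\<close>

lemma interval_union_deviation:
  assumes \<phi>: "mono \<phi>" "\<phi> \<in> measurable borel (count_space UNIV)" "\<And>x. \<phi> x \<le> n"
    and s: "s \<in> densities" and P: "\<And>j. measure (law s) (\<phi> -` {j}) \<le> 1 / real n"
    and n: "0 < n" and l: "0 < l" "l \<le> 1"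
    and A: "interval_union k A" "A \<in> sets borel"
    and up: "\<And>Q. Q \<in> switch_sets n (2 * k) \<Longrightarrow> l * (hits n (parity_set \<phi> Q) X - real n * measure (law s) (parity_set \<phi> Q))
        \<le> l\<^sup>2 * (real n * measure (law s) (parity_set \<phi> Q)) + w"
    and lo: "\<And>Q. Q \<in> switch_sets n (2 * k) \<Longrightarrow> - l * (hits n (parity_set \<phi> Q) X - real n * measure (law s) (parity_set \<phi> Q))
        \<le> l\<^sup>2 * (real n * measure (law s) (parity_set \<phi> Q)) + w"
  shows "\<bar>hits n A X - real n * measure (law s) A\<bar> \<le> l * (real n * measure (law s) A) + 4 * real k + w / l"
proof -
  interpret L: prob_space "law s" by (rule prob_space_law) fact
  obtain Q1 Q2 where Q: "Q1 \<in> switch_sets n (2 * k)" "Q2 \<in> switch_sets n (2 * k)"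
    "parity_set \<phi> Q1 \<subseteq> A" "A \<subseteq> parity_set \<phi> Q2"
    "measure (law s) (parity_set \<phi> Q2) \<le> measure (law s) (parity_set \<phi> Q1) + 2 * real k * (1 / real n)"
    using interval_union_sandwich[OF \<phi> prob_space_law[OF s] _ P A(1)] by auto
  define p p1 p2 where "p = real n * measure (law s) A"
    and "p1 = real n * measure (law s) (parity_set \<phi> Q1)" and "p2 = real n * measure (law s) (parity_set \<phi> Q2)"
  have m: "measure (law s) (parity_set \<phi> Q1) \<le> measure (law s) A" "measure (law s) A \<le> measure (law s) (parity_set \<phi> Q2)"
    using Q A(2) parity_set_measurable[OF \<phi>(2)] by (auto intro!: L.finite_measure_mono)
  have p: "p1 \<le> p" "p \<le> p2" unfolding p_def p1_def p2_def using m by (auto intro!: mult_left_mono)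
  have "p2 \<le> real n * (measure (law s) (parity_set \<phi> Q1) + 2 * real k * (1 / real n))"
    unfolding p2_def by (intro mult_left_mono Q) auto
  also have "\<dots> = p1 + 2 * real k" using n by (simp add: p1_def distrib_left)
  finally have p12: "p2 \<le> p1 + 2 * real k" .
  have "hits n A X - p2 \<le> hits n (parity_set \<phi> Q2) X - p2" using hits_mono[OF Q(4)] by simp
  also have "\<dots> \<le> l * p2 + w / l"
  proof -
    have "l * (hits n (parity_set \<phi> Q2) X - p2) \<le> l * (l * p2 + w / l)"
      using up[OF Q(2)] l by (simp add: p2_def power2_eq_square algebra_simps)
    then show ?thesis using l by simp
  qed
  also have "l * p2 \<le> l * p + 2 * real k"
  proof -
    have "l * p2 \<le> l * (p + 2 * real k)" using p p12 l by (intro mult_left_mono) auto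
    also have "\<dots> \<le> l * p + 1 * (2 * real k)" unfolding distrib_left using l by (intro add_left_mono mult_right_mono) auto
    finally show ?thesis by simp
  qed
  finally have 1: "hits n A X - p \<le> l * p + 4 * real k + w / l" using p p12 by simp
  have "p1 - hits n A X \<le> p1 - hits n (parity_set \<phi> Q1) X" using hits_mono[OF Q(3)] by simp
  also have "\<dots> \<le> l * p1 + w / l"
  proof -
    have "l * (p1 - hits n (parity_set \<phi> Q1) X) \<le> l * (l * p1 + w / l)"
      using lo[OF Q(1)] l by (simp add: p1_def power2_eq_square algebra_simps)
    then show ?thesis using l by simp
  qed
  also have "l * p1 \<le> l * p" using p l by (intro mult_left_mono) auto
  finally have 2: "p - hits n A X \<le> l * p + 4 * real k + w / l" using p p12 by simp
  show ?thesis using 1 2 unfolding p_def by (simp add: abs_le_iff)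
qed

text \<open>Average the deviations of the level sets over the layers. The weight
  \<open>i / M\<close> in the variance terms reconstructs at most the integral of \<open>f\<close>
  squared, while its inverse in the cost sums to \<open>harm M\<close>. Two families of level sets
  give \<open>8 * k\<close> and the factor 2 before \<open>harm M\<close>; discretizing the
  empirical sum and the mean gives \<open>2 * n / M\<close>.\<close>

lemma function_deviation:
  fixes f :: "real \<Rightarrow> real" and \<epsilon> :: real
  assumes s: "s \<in> densities" and f: "f \<in> borel_measurable borel" "\<And>x. \<bar>f x\<bar> \<le> 1"
    and M: "0 < M" and e: "0 < \<epsilon>" "\<epsilon> \<le> 1"
    and dev: "\<And>i A. i \<in> {1..M} \<Longrightarrow> A = {x. real i / real M < f x} \<or> A = {x. f x < - (real i / real M)} \<Longrightarrow>
      \<bar>hits n A X - real n * measure (law s) A\<bar>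
        \<le> \<epsilon> * real i / real M * (real n * measure (law s) A) + 4 * real k + w / (\<epsilon> * real i / real M)"
  shows "(\<Sum>i\<in>{1..n}. f (X i)) - real n * (\<integral>x. f x \<partial>law s)
    \<le> \<epsilon> * real n * (\<integral>x. (f x)\<^sup>2 \<partial>law s) + 2 * real n / real M + 8 * real k + 2 / \<epsilon> * harm M * w"
proof -
  interpret L: prob_space "law s" by (rule prob_space_law) fact
  note [measurable] = f(1)
  define A where "A i = {x. real i / real M < f x}" for i :: nat
  define B where "B i = {x. f x < - (real i / real M)}" for i :: nat
  have AB[measurable]: "A i \<in> sets borel" "B i \<in> sets borel" for i
    unfolding A_def B_def by measurable
  have ind: "indicator {real i / real M<..} (f x) = (indicator (A i) x :: real)"
     "indicator {..<- (real i / real M)} (f x) = (indicator (B i) x :: real)" for i x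
    by (auto simp: A_def B_def indicator_def)
  have L1: "\<bar>f x - (\<Sum>i\<in>{1..M}. indicator (A i) x - indicator (B i) x) / real M\<bar> \<le> 1 / real M" for x
    using layer_sum(1)[OF M f(2)[of x]] unfolding ind .
  have L2: "(\<Sum>i\<in>{1..M}. real i / real M * (indicator (A i) x + indicator (B i) x)) / real M \<le> (f x)\<^sup>2" for x
    using layer_sum(2)[OF M f(2)[of x]] unfolding ind .
  have intI: "integrable (law s) (indicator C :: real \<Rightarrow> real)" if "C \<in> sets borel" for C
    using that by (intro L.integrable_const_bound[of _ 1]) (auto simp: indicator_def)
  have intf: "integrable (law s) f" using f by (intro L.integrable_const_bound[of _ 1]) auto
  have intf2: "integrable (law s) (\<lambda>x. (f x)\<^sup>2)"
    using f by (intro L.integrable_const_bound[of _ 1]) (auto simp: abs_square_le_1)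
  define pA pB where "pA i = measure (law s) (A i)" and "pB i = measure (law s) (B i)" for i
  have low: "(\<integral>x. f x \<partial>law s) \<ge> (\<Sum>i\<in>{1..M}. pA i - pB i) / real M - 1 / real M"
  proof -
    have i0: "integrable (law s) (\<lambda>x. (\<Sum>i\<in>{1..M}. indicator (A i) x - indicator (B i) x) / real M)"
      by (intro integrable_divide Bochner_Integration.integrable_sum Bochner_Integration.integrable_diff intI AB)
    have "(\<integral>x. (\<Sum>i\<in>{1..M}. indicator (A i) x - indicator (B i) x) / real M - 1 / real M \<partial>law s) \<le> (\<integral>x. f x \<partial>law s)"
    proof (rule integral_mono)
      show "integrable (law s) (\<lambda>x. (\<Sum>i\<in>{1..M}. indicator (A i) x - indicator (B i) x) / real M - 1 / real M)"
        by (intro Bochner_Integration.integrable_diff[OF i0] L.integrable_const)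
      show "(\<Sum>i\<in>{1..M}. indicator (A i) x - indicator (B i) x) / real M - 1 / real M \<le> f x" for x
        using L1[of x] by (simp only: abs_le_iff) linarith
    qed (rule intf)
    also have "(\<integral>x. (\<Sum>i\<in>{1..M}. indicator (A i) x - indicator (B i) x) / real M - 1 / real M \<partial>law s)
       = (\<Sum>i\<in>{1..M}. pA i - pB i) / real M - 1 / real M"
      by (subst Bochner_Integration.integral_diff[OF i0 L.integrable_const])
         (simp add: Bochner_Integration.integral_sum intI AB pA_def pB_def L.prob_space[simplified])
    finally show ?thesis .
  qed
  have sq: "(\<Sum>i\<in>{1..M}. real i / real M * (pA i + pB i)) / real M \<le> (\<integral>x. (f x)\<^sup>2 \<partial>law s)"
  proof -
    have "(\<integral>x. (\<Sum>i\<in>{1..M}. real i / real M * (indicator (A i) x + indicator (B i) x)) / real M \<partial>law s) \<le> (\<integral>x. (f x)\<^sup>2 \<partial>law s)"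
      by (rule integral_mono[OF _ intf2 L2])
         (intro integrable_divide Bochner_Integration.integrable_sum integrable_mult_right Bochner_Integration.integrable_add intI AB)
    also have "(\<integral>x. (\<Sum>i\<in>{1..M}. real i / real M * (indicator (A i) x + indicator (B i) x)) / real M \<partial>law s)
      = (\<Sum>i\<in>{1..M}. real i / real M * (pA i + pB i)) / real M"
      by (simp add: Bochner_Integration.integral_sum Bochner_Integration.integral_add intI AB pA_def pB_def)
    finally show ?thesis .
  qed
  have up: "(\<Sum>j\<in>{1..n}. f (X j)) \<le> (\<Sum>i\<in>{1..M}. hits n (A i) X - hits n (B i) X) / real M + real n / real M"
  proof -
    have "(\<Sum>j\<in>{1..n}. f (X j)) \<le> (\<Sum>j\<in>{1..n}. (\<Sum>i\<in>{1..M}. indicator (A i) (X j) - indicator (B i) (X j)) / real M + 1 / real M)"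
    proof (rule sum_mono)
      fix j
      show "f (X j) \<le> (\<Sum>i\<in>{1..M}. indicator (A i) (X j) - indicator (B i) (X j)) / real M + 1 / real M"
        using L1[of "X j"] by (simp only: abs_le_iff) linarith
    qed
    also have "\<dots> = (\<Sum>j\<in>{1..n}. \<Sum>i\<in>{1..M}. indicator (A i) (X j) - indicator (B i) (X j)) / real M + real n / real M"
      unfolding sum.distrib sum_divide_distrib[symmetric] by simp
    also have "(\<Sum>j\<in>{1..n}. \<Sum>i\<in>{1..M}. indicator (A i) (X j) - indicator (B i) (X j))
       = (\<Sum>i\<in>{1..M}. hits n (A i) X - hits n (B i) X)"
      unfolding hits_def sum_subtractf[symmetric] by (rule sum.swap)
    finally show ?thesis .
  qed
  \<comment> \<open>Layer \<open>i\<close> needs an upper deviation for \<open>A i\<close> and a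
    lower one for \<open>B i\<close>, which enters with a minus sign.\<close>
  have each: "(hits n (A i) X - hits n (B i) X) - real n * (pA i - pB i)
     \<le> \<epsilon> * real n * (real i / real M * (pA i + pB i)) + 8 * real k + 2 * w * real M / \<epsilon> * (1 / real i)"
    if "i \<in> {1..M}" for i
  proof -
    have "hits n (A i) X - real n * pA i \<le> \<epsilon> * real i / real M * (real n * pA i) + 4 * real k + w / (\<epsilon> * real i / real M)"
      using dev[OF that, of "A i"] unfolding A_def pA_def by (simp add: abs_le_iff)
    moreover have "real n * pB i - hits n (B i) X \<le> \<epsilon> * real i / real M * (real n * pB i) + 4 * real k + w / (\<epsilon> * real i / real M)"
      using dev[OF that, of "B i"] unfolding B_def pB_def by (simp add: abs_le_iff)
    moreover have "w / (\<epsilon> * real i / real M) = w * real M / \<epsilon> * (1 / real i)" by simp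
    moreover have "\<epsilon> * real i / real M * (real n * pA i) + \<epsilon> * real i / real M * (real n * pB i) = \<epsilon> * real n * (real i / real M * (pA i + pB i))"
      by (simp add: algebra_simps add_divide_distrib)
    ultimately show ?thesis by (simp add: right_diff_distrib)
  qed
  have "(\<Sum>i\<in>{1..M}. hits n (A i) X - hits n (B i) X) - real n * (\<Sum>i\<in>{1..M}. pA i - pB i)
    = (\<Sum>i\<in>{1..M}. (hits n (A i) X - hits n (B i) X) - real n * (pA i - pB i))"
    by (simp add: sum_subtractf sum_distrib_left right_diff_distrib)
  also have "\<dots> \<le> (\<Sum>i\<in>{1..M}. \<epsilon> * real n * (real i / real M * (pA i + pB i)) + 8 * real k + 2 * w * real M / \<epsilon> * (1 / real i))"
    by (intro sum_mono each)
  also have "\<dots> = \<epsilon> * real n * (\<Sum>i\<in>{1..M}. real i / real M * (pA i + pB i)) + real M * (8 * real k) + 2 * w * real M / \<epsilon> * harm M"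
    unfolding sum.distrib sum_distrib_left[symmetric] by (simp add: harm_def inverse_eq_divide)
  finally have *: "(\<Sum>i\<in>{1..M}. hits n (A i) X - hits n (B i) X) - real n * (\<Sum>i\<in>{1..M}. pA i - pB i)
    \<le> \<epsilon> * real n * (\<Sum>i\<in>{1..M}. real i / real M * (pA i + pB i)) + real M * (8 * real k) + 2 * w * real M / \<epsilon> * harm M" .
  define H where "H = (\<Sum>i\<in>{1..M}. hits n (A i) X - hits n (B i) X)"
  define Q where "Q = (\<Sum>i\<in>{1..M}. pA i - pB i)"
  define V where "V = (\<Sum>i\<in>{1..M}. real i / real M * (pA i + pB i))"
  have "(H - real n * Q) / real M \<le> (\<epsilon> * real n * V + real M * (8 * real k) + 2 * w * real M / \<epsilon> * harm M) / real M"
    using * unfolding H_def Q_def V_def by (intro divide_right_mono) auto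
  also have "\<dots> = \<epsilon> * real n * (V / real M) + 8 * real k + 2 / \<epsilon> * harm M * w"
    using M by (simp add: add_divide_distrib)
  also have "\<dots> \<le> \<epsilon> * real n * (\<integral>x. (f x)\<^sup>2 \<partial>law s) + 8 * real k + 2 / \<epsilon> * harm M * w"
    using sq e unfolding V_def by (intro add_right_mono mult_left_mono) auto
  finally have 1: "H / real M - real n * (Q / real M) \<le> \<epsilon> * real n * (\<integral>x. (f x)\<^sup>2 \<partial>law s) + 8 * real k + 2 / \<epsilon> * harm M * w"
    by (simp add: diff_divide_distrib)
  have "real n * (Q / real M - 1 / real M) \<le> real n * (\<integral>x. f x \<partial>law s)"
    using low unfolding Q_def by (intro mult_left_mono) auto
  then have "real n * (Q / real M) - real n / real M \<le> real n * (\<integral>x. f x \<partial>law s)" by (simp add: right_diff_distrib)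
  moreover have "(\<Sum>j\<in>{1..n}. f (X j)) \<le> H / real M + real n / real M" using up unfolding H_def .
  ultimately show ?thesis using 1 by simp
qed

section \<open>Risk bound\<close>

lemma integral_law:
  assumes "s \<in> densities" "f \<in> borel_measurable borel"
  shows "(\<integral>x. f x \<partial>law s) = (\<integral>x. f x * s x \<partial>lborel)"
  unfolding law_def using assms densities_measurable[OF assms(1)]
  by (subst integral_density) (auto simp: densities_nonneg mult.commute)

lemma log_plus_ge: "1 \<le> log_plus x" "ln x \<le> log_plus x"
  by (auto simp: log_plus_def)

text \<open>This counts the triples of a code, a layer and a sign used in the uniform bound;
  \<open>4 * D + 4\<close> is twice the number of intervals in a level set.\<close>

lemma ln_card_union_bound_le:
  assumes D: "1 \<le> D" "D < n"
  shows "ln (real (card (switch_sets n (4 * D + 4)) * (2 * (n div D)))) \<le> 12 * real D * log_plus (real n / real D)"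
proof -
  define L where "L = log_plus (real n / real D)"
  have L: "1 \<le> L" "ln (real n / real D) \<le> L" unfolding L_def by (rule log_plus_ge)+
  have l0: "0 \<le> ln (real n / real D)" using D by simp
  \<comment> \<open>This weight balances the counting bound: \<open>x * (n + 2)\<close> is at most
    \<open>2 * D\<close>, and \<open>- ln x\<close> is the logarithm of
    \<open>n / D\<close>.\<close>
  define x where "x = real D / real n"
  have x: "0 < x" "x \<le> 1" using D by (auto simp: x_def)
  define q where "q = real (card (switch_sets n (4 * D + 4)))"
  have "{} \<in> switch_sets n (4 * D + 4)" by (simp add: switch_sets_def)
  then have q: "0 < q" unfolding q_def by (metis card_gt_0_iff empty_iff finite_switch_sets of_nat_0_less_iff)
  have M: "0 < n div D" using D by (simp add: div_greater_zero_iff)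
  have "ln (q * x ^ (4 * D + 4)) \<le> ln (exp (x * real (n + 2)))"
    using card_switch_sets_le[OF x, of n "4 * D + 4"] q x by (subst ln_le_cancel_iff) (auto simp: q_def)
  then have "ln q \<le> x * real (n + 2) - real (4 * D + 4) * ln x"
    using q x by (simp add: ln_mult ln_realpow)
  also have "- ln x = ln (real n / real D)" using D by (simp add: x_def ln_div)
  then have "x * real (n + 2) - real (4 * D + 4) * ln x = x * real (n + 2) + real (4 * D + 4) * ln (real n / real D)"
    by (metis diff_conv_add_uminus mult_minus_right)
  also have "\<dots> \<le> 2 * real D + 8 * real D * L"
  proof (rule add_mono)
    have "x * real (n + 2) \<le> x * (2 * real n)" using D x by (intro mult_left_mono) auto
    also have "\<dots> = 2 * real D" using D by (simp add: x_def)
    finally show "x * real (n + 2) \<le> 2 * real D" .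
    show "real (4 * D + 4) * ln (real n / real D) \<le> 8 * real D * L"
      using D L l0 by (intro mult_mono) auto
  qed
  finally have 1: "ln q \<le> 2 * real D + 8 * real D * L" .
  have "ln (real (2 * (n div D))) = ln 2 + ln (real (n div D))" using M by (simp add: ln_mult)
  also have "\<dots> \<le> 1 + ln (real n / real D)"
  proof (intro add_mono)
    show "ln 2 \<le> (1::real)" using ln_2_less_1 by simp
    have "real (n div D) \<le> real n / real D" by (rule of_nat_div_le_of_nat)
    then show "ln (real (n div D)) \<le> ln (real n / real D)" using M D by (subst ln_le_cancel_iff) auto
  qed
  also have "\<dots> \<le> L + L" using L by linarith
  finally have 2: "ln (real (2 * (n div D))) \<le> 2 * L" by simp
  have "ln (real (card (switch_sets n (4 * D + 4)) * (2 * (n div D)))) = ln q + ln (real (2 * (n div D)))"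
    unfolding of_nat_mult[of "card (switch_sets n (4 * D + 4))"] q_def[symmetric]
    using q M by (intro ln_mult_pos) auto
  also have "\<dots> \<le> (2 * real D * L + 8 * real D * L) + 2 * (real D * L)"
  proof (intro add_mono order_trans[OF 1] order_trans[OF 2] order_refl mult_left_mono)
    show "2 * real D \<le> 2 * real D * L" using L D by simp
    show "L \<le> real D * L" using L D by simp
  qed simp
  finally show ?thesis unfolding L_def by (simp add: algebra_simps)
qed

text \<open>A single integrable remainder serves all log-concave \<open>u\<close>, so no supremum
  over \<open>u\<close> has to be integrated.\<close>

lemma uniform_rho_T_bound:
  assumes D: "1 \<le> D" "D < n" and s: "s \<in> densities" and t: "t \<in> log_affine_densities D"
  obtains R where "integrable (iid_sample n s) R"
    "(\<integral>X. R X \<partial>iid_sample n s) \<le> 2916 * real D * (log_plus (real n / real D)) ^ 3"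
    "\<And>X u. u \<in> log_concave_densities \<Longrightarrow>
      rho_T n X t u \<le> 2 * real n * (hellinger s t)\<^sup>2 - real n / 6 * (hellinger s u)\<^sup>2 + R X / sqrt 2"
proof -
  interpret L: prob_space "law s" by (rule prob_space_law) fact
  interpret I: prob_space "iid_sample n s" unfolding iid_sample_def law_def[symmetric]
    by (intro prob_space_PiM L.prob_space_axioms)
  have n: "0 < n" using D by simp
  obtain \<phi> where \<phi>: "mono \<phi>" "\<phi> \<in> measurable borel (count_space UNIV)" "\<And>x. \<phi> x \<le> n"
    "\<And>j. measure (law s) (\<phi> -` {j}) \<le> 1 / real n"
    using quantile_grid[OF s n] by blast
  \<comment> \<open>With this many layers the discretization error \<open>2 * n / M\<close> is at
    most \<open>4 * D\<close>, and \<open>harm M\<close> is at most twice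
    \<open>log_plus (n / D)\<close>.\<close>
  define M where "M = n div D"
  have M: "0 < M" using D by (simp add: M_def div_greater_zero_iff)
  define k where "k = 2 * D + 2"
  define QQ where "QQ = switch_sets n (2 * k)"
  define J where "J = QQ \<times> ({1..M} \<times> {True, False})"
  define A where "A = (\<lambda>(Q, i::nat, b::bool). parity_set \<phi> Q)"
  \<comment> \<open>The exponent is proportional to the height of the layer. The slope 1/60 times
    the 6 of the second moment bound leaves 1/10 of each squared distance; its inverse gives the 120
    in \<open>R\<close>.\<close>
  define l where "l = (\<lambda>(Q::nat set, i, b). (if b then 1 else - 1) * (1/60 * real i / real M))"
  have l01: "0 < 1/60 * real i / real M" "1/60 * real i / real M \<le> 1" if "i \<in> {1..M}" for i
    using that M by (auto simp: divide_le_eq)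
  have "{} \<in> QQ" by (simp add: QQ_def switch_sets_def)
  then have "J \<noteq> {}" using M by (auto simp: J_def)
  moreover have "finite J" by (simp add: J_def QQ_def)
  moreover have "A j \<in> sets borel" if "j \<in> J" for j
    by (cases j) (simp add: A_def parity_set_measurable[OF \<phi>(2)])
  moreover have "\<bar>l j\<bar> \<le> 1" if "j \<in> J" for j
    using that l01 by (cases j) (auto simp: l_def J_def abs_if dest: l01 intro: order_trans[of _ 0])
  ultimately obtain W where W: "integrable (iid_sample n s) W" "(\<integral>X. W X \<partial>iid_sample n s) \<le> ln (real (card J))"
    "\<And>X j. j \<in> J \<Longrightarrow> l j * (hits n (A j) X - real n * measure (law s) (A j))
        \<le> (l j)\<^sup>2 * (real n * measure (law s) (A j)) + W X"
    using exponential_union_bound[OF s, of J A l n] by metis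
  define R where "R X = 2 * real n / real M + 8 * real k + 120 * harm M * W X" for X
  show ?thesis
  proof (rule that[of R])
    show "integrable (iid_sample n s) R" unfolding R_def using W(1) by simp
    define Lp where "Lp = log_plus (real n / real D)"
    have Lp: "1 \<le> Lp" "ln (real n / real D) \<le> Lp" unfolding Lp_def by (rule log_plus_ge)+
    have EW: "(\<integral>X. W X \<partial>iid_sample n s) \<le> 12 * real D * Lp"
    proof -
      have "2 * k = 4 * D + 4" by (simp add: k_def)
      moreover have "card J = card QQ * (2 * M)" by (simp add: J_def card_cartesian_product)
      ultimately have "card J = card (switch_sets n (4 * D + 4)) * (2 * (n div D))"
        by (simp only: QQ_def M_def)
      then show ?thesis using W(2) ln_card_union_bound_le[OF D] unfolding Lp_def by simp
    qed
    have nM: "real n / real M \<le> 2 * real D"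
    proof -
      have "n = M * D + n mod D" by (simp add: M_def)
      moreover have "n mod D < D" using D by simp
      moreover have "1 * D \<le> M * D" using M by (intro mult_le_mono1) simp
      ultimately have "n \<le> 2 * (M * D)" by linarith
      then have "n \<le> 2 * D * M" by (simp add: mult.commute mult.left_commute)
      then have "real n \<le> 2 * real D * real M" by (metis of_nat_le_iff of_nat_mult of_nat_numeral)
      then show ?thesis using M by (simp add: divide_le_eq)
    qed
    have hM: "harm M \<le> 2 * Lp"
    proof -
      have "harm M - ln (real M) \<le> harm 1 - ln (real 1)" using M by (intro euler_mascheroni_sequence_decreasing) auto
      then have "harm M \<le> 1 + ln (real M)" by (simp add: harm_def)
      also have "ln (real M) \<le> ln (real n / real D)" using M D unfolding M_def
        by (subst ln_le_cancel_iff) (auto simp: of_nat_div_le_of_nat)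
      finally show ?thesis using Lp by simp
    qed
    have "(\<integral>X. R X \<partial>iid_sample n s) = 2 * real n / real M + 8 * real k + 120 * harm M * (\<integral>X. W X \<partial>iid_sample n s)"
      unfolding R_def using W(1) by (simp add: I.prob_space)
    also have "\<dots> \<le> 4 * real D + 32 * real D + 120 * (2 * Lp) * (12 * real D * Lp)"
    proof (intro add_mono)
      show "2 * real n / real M \<le> 4 * real D" using nM by simp
      show "8 * real k \<le> 32 * real D" using D by (simp add: k_def)
      have "120 * harm M * (\<integral>X. W X \<partial>iid_sample n s) \<le> 120 * harm M * (12 * real D * Lp)"
        using EW by (intro mult_left_mono) (auto simp: harm_nonneg)
      also have "\<dots> \<le> 120 * (2 * Lp) * (12 * real D * Lp)"
        using hM Lp by (intro mult_right_mono mult_left_mono) auto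
      finally show "120 * harm M * (\<integral>X. W X \<partial>iid_sample n s) \<le> 120 * (2 * Lp) * (12 * real D * Lp)" .
    qed
    also have "\<dots> = 36 * real D + 2880 * real D * Lp ^ 2" by (simp add: power2_eq_square)
    \<comment> \<open>The computation yields a squared logarithm; since \<open>Lp \<ge> 1\<close>,
      it is relaxed to the cube of the claimed rate.\<close>
    also have "\<dots> \<le> 36 * (real D * Lp ^ 3) + 2880 * (real D * Lp ^ 3)"
    proof -
      have "1 \<le> Lp ^ 3" "Lp ^ 2 \<le> Lp ^ 3" using Lp by (auto intro: power_increasing)
      then have "real D * 1 \<le> real D * Lp ^ 3" "real D * Lp ^ 2 \<le> real D * Lp ^ 3" by (intro mult_left_mono; simp)+
      then show ?thesis by simp
    qed
    finally show "(\<integral>X. R X \<partial>iid_sample n s) \<le> 2916 * real D * (log_plus (real n / real D)) ^ 3"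
      unfolding Lp_def by simp
  next
    fix X u assume u: "u \<in> log_concave_densities"
    have td: "t \<in> densities" and ud: "u \<in> densities"
      using t u log_affine_subset_log_concave log_concave_subset_densities by blast+
    note [measurable] = densities_measurable[OF td] densities_measurable[OF ud]
    define f where "f x = psi_ratio (u x) (t x)" for x
    have f: "f \<in> borel_measurable borel" "\<And>x. \<bar>f x\<bar> \<le> 1"
      unfolding f_def using abs_psi_ratio_le_1 densities_nonneg[OF td] densities_nonneg[OF ud] by auto
    note [measurable] = f(1)
    have dev: "(\<Sum>i\<in>{1..n}. f (X i)) - real n * (\<integral>x. f x \<partial>law s)
      \<le> 1/60 * real n * (\<integral>x. (f x)\<^sup>2 \<partial>law s) + 2 * real n / real M + 8 * real k + 2 / (1/60) * harm M * W X"
    proof (rule function_deviation[OF s f M])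
      fix i C assume i: "i \<in> {1..M}" and C: "C = {x. real i / real M < f x} \<or> C = {x. f x < - (real i / real M)}"
      have c: "0 < real i / real M" "real i / real M \<le> 1" using i M by auto
      have Ck: "interval_union k C"
        using psi_ratio_level_sets_interval_union[OF u t c] C unfolding f_def k_def by auto
      have Cb: "C \<in> sets borel" using C by auto
      show "\<bar>hits n C X - real n * measure (law s) C\<bar>
        \<le> 1/60 * real i / real M * (real n * measure (law s) C) + 4 * real k + W X / (1/60 * real i / real M)"
      proof (rule interval_union_deviation[OF \<phi>(1-3) s \<phi>(4) n l01[OF i] Ck Cb])
        fix Q assume Q: "Q \<in> switch_sets n (2 * k)"
        show "1/60 * real i / real M * (hits n (parity_set \<phi> Q) X - real n * measure (law s) (parity_set \<phi> Q))
          \<le> (1/60 * real i / real M)\<^sup>2 * (real n * measure (law s) (parity_set \<phi> Q)) + W X"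
          using W(3)[of "(Q, i, True)" X] Q i by (simp add: J_def QQ_def A_def l_def)
        show "- (1/60 * real i / real M) * (hits n (parity_set \<phi> Q) X - real n * measure (law s) (parity_set \<phi> Q))
          \<le> (1/60 * real i / real M)\<^sup>2 * (real n * measure (law s) (parity_set \<phi> Q)) + W X"
          using W(3)[of "(Q, i, False)" X] Q i by (simp add: J_def QQ_def A_def l_def)
      qed
    qed auto
    define h0 hu where "h0 = (hellinger s t)\<^sup>2" and "hu = (hellinger s u)\<^sup>2"
    have hnn: "0 \<le> h0" "0 \<le> hu" by (auto simp: h0_def hu_def)
    define c where "c = 1 / sqrt (2::real)"
    have c: "0 \<le> c" "c \<le> 71/100"
    proof -
      have "100/71 \<le> sqrt (2::real)" by (intro real_le_rsqrt) (simp add: power2_eq_square)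
      then show "c \<le> 71/100" unfolding c_def by (simp add: divide_le_eq)
    qed (simp add: c_def)
    define E where "E = (\<integral>x. f x \<partial>law s)"
    define V where "V = (\<integral>x. (f x)\<^sup>2 \<partial>law s)"
    have E: "E = (\<integral>x. psi_ratio (u x) (t x) * s x \<partial>lborel)" unfolding E_def f_def using s by (intro integral_law) measurable
    have V: "V \<le> 6 * (h0 + hu)"
    proof -
      have "V = (\<integral>x. (psi_ratio (u x) (t x))\<^sup>2 * s x \<partial>lborel)" unfolding V_def f_def using s by (intro integral_law) measurable
      then show ?thesis using psi_ratio_second_moment_le[OF s td ud] by (simp add: h0_def hu_def)
    qed
    define G where "G = (hellinger t (\<lambda>x. (t x + u x) / 2))\<^sup>2 - (hellinger u (\<lambda>x. (t x + u x) / 2))\<^sup>2"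
    have mean: "1/2 * G + c * E \<le> (1 + c) * h0 - (1 - c) * hu"
      using rho_T_expectation_le[OF s td ud] unfolding G_def E c_def h0_def hu_def .
    define Z where "Z = (\<Sum>i\<in>{1..n}. f (X i))"
    have devZ: "Z - real n * E \<le> real n / 10 * (h0 + hu) + R X"
    proof -
      have "1/60 * real n * V \<le> 1/60 * real n * (6 * (h0 + hu))" using V by (intro mult_left_mono) auto
      also have "\<dots> = real n / 10 * (h0 + hu)" by (simp add: algebra_simps)
      finally have "1/60 * real n * V \<le> real n / 10 * (h0 + hu)" .
      moreover have "Z - real n * E \<le> 1/60 * real n * V + R X"
        using dev unfolding Z_def[symmetric] E_def[symmetric] V_def[symmetric] R_def by simp
      ultimately show ?thesis by linarith
    qed
    have "rho_T n X t u = real n / 2 * G + c * Z"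
      unfolding rho_T_psi_ratio[OF td ud] G_def c_def Z_def f_def by simp
    also have "\<dots> = real n * (1/2 * G + c * E) + c * (Z - real n * E)" by (simp add: algebra_simps)
    also have "\<dots> \<le> real n * ((1 + c) * h0 - (1 - c) * hu) + c * (real n / 10 * (h0 + hu) + R X)"
      using mean devZ c by (intro add_mono mult_left_mono) auto
    \<comment> \<open>From \<open>c \<le> 71/100\<close>: \<open>1 + 11/10 * c\<close> stays below
      2, and \<open>1 - 11/10 * c\<close> stays above 1/6.\<close>
    also have "\<dots> \<le> 2 * real n * h0 - real n / 6 * hu + c * R X"
    proof -
      have "c * (real n * h0) \<le> 71/100 * (real n * h0)" "c * (real n * hu) \<le> 71/100 * (real n * hu)"
        using c hnn by (intro mult_right_mono mult_nonneg_nonneg; simp)+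
      moreover have "0 \<le> real n * h0" "0 \<le> real n * hu" using hnn by auto
      moreover have "real n * ((1 + c) * h0 - (1 - c) * hu) + c * (real n / 10 * (h0 + hu) + R X)
        = real n * h0 + 11/10 * (c * (real n * h0)) + 11/10 * (c * (real n * hu)) - real n * hu + c * R X"
        by (simp add: field_simps)
      moreover have "2 * real n * h0 = 2 * (real n * h0)" "real n / 6 * hu = 1/6 * (real n * hu)" by simp_all
      ultimately show ?thesis by linarith
    qed
    finally show "rho_T n X t u \<le> 2 * real n * (hellinger s t)\<^sup>2 - real n / 6 * (hellinger s u)\<^sup>2 + R X / sqrt 2"
      by (simp add: h0_def hu_def c_def)
  qed
qed

text \<open>The uniform bound is used twice: over all of \<open>S\<close> it gives the upper bound
  \<open>b\<close> for the criterion at \<open>t\<close>, and at a near minimizer \<open>v\<close>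
  its negative term isolates the distance from \<open>s\<close> to \<open>v\<close>.\<close>

lemma rho_estimator_risk_le:
  assumes est: "rho_estimator n log_concave_densities s_hat" and s: "s \<in> densities"
    and D: "1 \<le> D" "D < n" and t: "t \<in> log_affine_densities D"
  shows "(\<integral>X. (hellinger s (s_hat X))\<^sup>2 \<partial>iid_sample n s)
    \<le> 100000 * ((hellinger s t)\<^sup>2 + real D / real n * (log_plus (real n / real D)) ^ 3)"
proof -
  interpret L: prob_space "law s" by (rule prob_space_law) fact
  interpret I: prob_space "iid_sample n s" unfolding iid_sample_def law_def[symmetric]
    by (intro prob_space_PiM L.prob_space_axioms)
  have n: "0 < real n" using D by simp
  obtain S where S: "S \<subseteq> log_concave_densities" "log_concave_densities \<subseteq> hellinger_closure S"
    "\<And>X. X \<in> space (PiM {1..n} (\<lambda>_. borel)) \<Longrightarrow> s_hat X \<in> hellinger_closure (rho_minimizers n X S)"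
    using est unfolding rho_estimator_def by auto
  have Sd: "S \<subseteq> densities" using S(1) log_concave_subset_densities by blast
  have tc: "t \<in> hellinger_closure S" using t log_affine_subset_log_concave S(2) by blast
  obtain R where R: "integrable (iid_sample n s) R"
    "(\<integral>X. R X \<partial>iid_sample n s) \<le> 2916 * real D * (log_plus (real n / real D)) ^ 3"
    "\<And>X u. u \<in> log_concave_densities \<Longrightarrow>
      rho_T n X t u \<le> 2 * real n * (hellinger s t)\<^sup>2 - real n / 6 * (hellinger s u)\<^sup>2 + R X / sqrt 2"
    using uniform_rho_T_bound[OF D s t] by blast
  define h0 where "h0 = (hellinger s t)\<^sup>2"
  \<comment> \<open>Constants after multiplication by 12: a factor 6 clears \<open>n / 6\<close>,
    and a factor 2 pays for passing from a near minimizer to the estimator in the closure. Thus 4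
    becomes 48, 2 becomes 24, and 35.7 becomes 428.4, rounded up to 429.\<close>
  define B where "B X = 48 * h0 + (24 * (R X / sqrt 2) + 429) / real n" for X
  have sp: "space (iid_sample n s) = space (PiM {1..n} (\<lambda>_. borel :: real measure))"
    by (simp add: iid_sample_def space_PiM)
  have "AE X in iid_sample n s. (hellinger s (s_hat X))\<^sup>2 \<le> B X"
    using rho_minimizer_bound_closure[OF Sd tc s, of n] AE_space
  proof eventually_elim
    case (elim X)
    have sh: "s_hat X \<in> hellinger_closure (rho_minimizers n X S)" using S(3) elim(2) sp by blast
    then have shd: "s_hat X \<in> densities" by (simp add: hellinger_closure_def)
    have min: "2 * (hellinger s v)\<^sup>2 \<le> B X" if v: "v \<in> rho_minimizers n X S" for v
    proof -
      have vS: "v \<in> S" using v by (simp add: rho_minimizers_def)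
      define b where "b = 2 * real n * h0 + R X / sqrt 2"
      have "\<forall>u\<in>S. rho_T n X t u \<le> b"
      proof
        fix u assume "u \<in> S"
        then have "rho_T n X t u \<le> 2 * real n * (hellinger s t)\<^sup>2 - real n / 6 * (hellinger s u)\<^sup>2 + R X / sqrt 2"
          using R(3) S(1) by blast
        moreover have "0 \<le> real n / 6 * (hellinger s u)\<^sup>2" by simp
        ultimately show "rho_T n X t u \<le> b" unfolding b_def h0_def by linarith
      qed
      then have "0 \<le> rho_T n X t v + b + 35.7" using elim(1) v by blast
      moreover have "rho_T n X t v \<le> 2 * real n * h0 - real n / 6 * (hellinger s v)\<^sup>2 + R X / sqrt 2"
        unfolding h0_def using R(3) vS S(1) by blast
      ultimately have "real n / 6 * (hellinger s v)\<^sup>2 \<le> 4 * (real n * h0) + 2 * (R X / sqrt 2) + 35.7"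
        unfolding b_def by linarith
      then have "real n * (2 * (hellinger s v)\<^sup>2) \<le> real n * (48 * h0) + (24 * (R X / sqrt 2) + 429)"
        by (simp add: algebra_simps)
      also have "\<dots> = real n * B X" using n unfolding B_def distrib_left[of "real n" "48 * h0"] by simp
      finally show ?thesis using n by simp
    qed
    show ?case
    proof (rule field_le_epsilon)
      fix e :: real assume e: "0 < e"
      \<comment> \<open>The radius is such that twice its square is \<open>e\<close>.\<close>
      have "0 < sqrt (e / 2)" using e by simp
      then obtain v where v: "v \<in> rho_minimizers n X S" "hellinger (s_hat X) v < sqrt (e / 2)"
        using sh unfolding hellinger_closure_def by blast
      have vd: "v \<in> densities" using v(1) Sd by (auto simp: rho_minimizers_def)
      have "(hellinger (s_hat X) v)\<^sup>2 \<le> (sqrt (e / 2))\<^sup>2"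
        using v(2) by (intro power_mono) (auto simp: hellinger_def intro!: integral_nonneg_AE)
      then have "2 * (hellinger v (s_hat X))\<^sup>2 \<le> e" using e by (simp add: hellinger_commute)
      then show "(hellinger s (s_hat X))\<^sup>2 \<le> B X + e"
        using hellinger_sq_triangle[OF s vd shd] min[OF v(1)] by linarith
    qed
  qed
  note le = this
  have Bi: "integrable (iid_sample n s) B" unfolding B_def using R(1) by simp
  have "(\<integral>X. (hellinger s (s_hat X))\<^sup>2 \<partial>iid_sample n s) \<le> (\<integral>X. B X \<partial>iid_sample n s)"
  proof (rule integral_mono_AE'[OF Bi le])
    show "AE X in iid_sample n s. 0 \<le> B X" using le
      by eventually_elim (rule order_trans[OF zero_le_power2])
  qed
  also have "\<dots> = 48 * h0 + (24 / sqrt 2 * (\<integral>X. R X \<partial>iid_sample n s) + 429) / real n"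
    unfolding B_def using R(1) by (simp add: I.prob_space)
  also have "\<dots> \<le> 48 * h0 + (24 * (2916 * (real D * (log_plus (real n / real D)) ^ 3)) + 429 * (real D * (log_plus (real n / real D)) ^ 3)) / real n"
  proof (intro add_left_mono divide_right_mono add_mono)
    define Q where "Q = real D * (log_plus (real n / real D)) ^ 3"
    have "1 * 1 \<le> Q" unfolding Q_def using D log_plus_ge(1)[of "real n / real D"]
      by (intro mult_mono one_le_power) auto
    then show "429 \<le> 429 * (real D * (log_plus (real n / real D)) ^ 3)" by (simp add: Q_def)
    have "24 / sqrt 2 * (\<integral>X. R X \<partial>iid_sample n s) \<le> 24 / sqrt 2 * (2916 * Q)"
      using R(2) by (intro mult_left_mono) (auto simp: Q_def)
    also have "\<dots> \<le> 24 * (2916 * Q)"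
      using \<open>1 * 1 \<le> Q\<close> by (intro mult_right_mono) (auto simp: divide_le_eq)
    finally show "24 / sqrt 2 * (\<integral>X. R X \<partial>iid_sample n s) \<le> 24 * (2916 * (real D * (log_plus (real n / real D)) ^ 3))"
      by (simp add: Q_def)
  qed simp
  also have "\<dots> = 48 * h0 + 70413 * (real D / real n * (log_plus (real n / real D)) ^ 3)"
    by (simp add: algebra_simps add_divide_distrib[symmetric])
  also have "\<dots> \<le> 100000 * h0 + 100000 * (real D / real n * (log_plus (real n / real D)) ^ 3)"
  proof (intro add_mono mult_right_mono)
    show "0 \<le> real D / real n * (log_plus (real n / real D)) ^ 3"
      using log_plus_ge(1)[of "real n / real D"] by simp
  qed (auto simp: h0_def)
  finally show ?thesis by (simp add: h0_def)
qed

text \<open>For \<open>D < n\<close> this is the risk bound for one \<open>t\<close>, followed by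
  infima over \<open>t\<close> and \<open>D\<close>. For \<open>D \<ge> n\<close> the remainder is
  already at least 1, which bounds every squared Hellinger distance.\<close>

theorem corollary4:
  "\<exists>C::real. 0 < C \<and> C \<le> 1 \<and>
     (\<forall>n::nat. n \<ge> 3 \<longrightarrow>
       (\<forall>s_hat. rho_estimator n log_concave_densities s_hat \<longrightarrow>
         (\<forall>s\<in>densities.
            C * (\<integral>X. (hellinger s (s_hat X))\<^sup>2 \<partial>iid_sample n s)
            \<le> (INF D\<in>{1::nat..}. (INF t\<in>log_affine_densities D. (hellinger s t)\<^sup>2)
                 + real D / real n * (log_plus (real n / real D)) ^ 3))))"
proof (intro exI[of _ "1/100000"] conjI allI impI ballI)
  fix n :: nat and s_hat s
  assume n: "3 \<le> n" and est: "rho_estimator n log_concave_densities s_hat" and s: "s \<in> densities"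
  define E where "E = (\<integral>X. (hellinger s (s_hat X))\<^sup>2 \<partial>iid_sample n s)"
  have "1/100000 * E - real D / real n * (log_plus (real n / real D)) ^ 3 \<le> (hellinger s t)\<^sup>2"
    if D: "1 \<le> D" and t: "t \<in> log_affine_densities D" for D t
  proof (cases "D < n")
    case True
    then show ?thesis using rho_estimator_risk_le[OF est s D True t] by (simp add: E_def)
  next
    case False
    interpret L: prob_space "law s" by (rule prob_space_law) fact
    interpret I: prob_space "iid_sample n s" unfolding iid_sample_def law_def[symmetric]
      by (intro prob_space_PiM L.prob_space_axioms)
    have sp: "space (iid_sample n s) = space (PiM {1..n} (\<lambda>_. borel :: real measure))"
      by (simp add: iid_sample_def space_PiM)
    have "E \<le> (\<integral>X. 1 \<partial>iid_sample n s)" unfolding E_def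
    proof (rule integral_mono')
      fix X assume "X \<in> space (iid_sample n s)"
      then have "s_hat X \<in> densities"
        using est unfolding rho_estimator_def sp hellinger_closure_def by blast
      then show "(hellinger s (s_hat X))\<^sup>2 \<le> 1" by (rule hellinger_sq_le_1[OF s])
    qed auto
    also have "\<dots> = 1" by (simp add: I.prob_space)
    finally have "E \<le> 1" .
    moreover have "1 * 1 \<le> real D / real n * (log_plus (real n / real D)) ^ 3"
      using False n log_plus_ge(1)[of "real n / real D"] by (intro mult_mono one_le_power) auto
    ultimately show ?thesis using zero_le_power2[of "hellinger s t"] by linarith
  qed
  \<comment> \<open>The remainder is moved to the left because it is free of \<open>t\<close>; the
    inner infimum is then taken on the right alone.\<close>
  then have "1/100000 * E - real D / real n * (log_plus (real n / real D)) ^ 3 \<le> (INF t\<in>log_affine_densities D. (hellinger s t)\<^sup>2)"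
    if "1 \<le> D" for D
    using that by (intro cINF_greatest log_affine_densities_nonempty) auto
  then show "1/100000 * E \<le> (INF D\<in>{1::nat..}. (INF t\<in>log_affine_densities D. (hellinger s t)\<^sup>2)
                 + real D / real n * (log_plus (real n / real D)) ^ 3)"
    by (intro cINF_greatest) (auto simp: algebra_simps)
qed auto

end
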